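(* Let $\Omega\subset\mathbb{R}^3$ be a bounded convex domain with smooth boundary, $V\in L^2(\Omega)$, $V\ge0$, $\beta\ge0$, and $\phi_0\in H_0^1(\Omega)$ with $\|\phi_0\|_{L^2(\Omega)}=1$. Consider the following fully discrete scheme. The initial value is $$\phi_h^0=\frac{R_h\phi_0}{\|R_h\phi_0\|_{L^2(\Omega)}}.$$ For $0\le n\le N-1$ and given $\phi_h^n\in S_h$, first find $\tilde\phi_h^{n+1}\in S_h$ such that for all $v_h\in S_h$ $$\left(\frac{\tilde\phi_h^{n+1}-\phi_h^n}{\tau},v_h\right)_{L^2(\Omega)}+(\nabla\tilde\phi_h^{n+1},\nabla v_h)_{L^2(\Omega)}=-(V\phi_h^n,v_h)_{L^2(\Omega)}-\beta(|\phi_h^n|^2\phi_h^n,v_h)_{L^2(\Omega)}+\mu[\phi_h^n](\phi_h^n,v_h)_{L^2(\Omega)},$$ and then set $$\phi_h^{n+1}=\frac{\tilde\phi_h^{n+1}}{\|\tilde\phi_h^{n+1}\|_{L^2(\Omega)}}.$$ This scheme is well-posed for any $\tau>0$ and $h>0$; that is, for each $0\le n\le N-1$ the equation for $\tilde\phi_h^{n+1}$ has a unique solution in $S_h$, and $\|\tilde\phi_h^{n+1}\|_{L^2(\Omega)}\neq0$, so that the normalization defining $\phi_h^{n+1}$ makes sense.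
   Context: All functions are real-valued. For $0\neq v\in H_0^1(\Omega)$, $\mu[v]:=\frac{1}{\|v\|_{L^2(\Omega)}^2}\int_\Omega\left(|\nabla v|^2+V|v|^2+\beta|v|^4\right)\mathrm{d}x$. $T>0$ is a fixed final time, $N\in\mathbb{N}$ is the number of time steps, and $\tau=T/N$ is the time step. $\mathcal{T}_h$ is a shape regular and quasi-uniform triangulation of $\Omega$ with mesh size $h$, and $S_h\subset H_0^1(\Omega)$ is the corresponding piecewise linear finite element space. The Ritz projection $R_h:H_0^1(\Omega)\to S_h$ is defined by $(\nabla R_hu,\nabla v_h)_{L^2(\Omega)}=(\nabla u,\nabla v_h)_{L^2(\Omega)}$ for all $u\in H_0^1(\Omega)$ and $v_h\in S_h$.
   Formalization: The formal theorem adds the assumption that the L² norm of R_hφ_0 is nonzero; without it the initial value φ_h^0 = R_hφ_0/‖R_hφ_0‖ is undefined, e.g. when the mesh has no interior node or φ_0 is gradient-orthogonal to S_h. *)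

theory Defs
  imports "HOL-Analysis.Analysis"
begin

type_synonym space3 = "real^3"

section \<open>Smooth functions and domains with smooth boundary\<close>

definition partial :: "3 \<Rightarrow> (space3 \<Rightarrow> real) \<Rightarrow> space3 \<Rightarrow> real" where
  "partial i f x = frechet_derivative f (at x) (axis i 1)"

primrec iter_partial :: "3 list \<Rightarrow> (space3 \<Rightarrow> real) \<Rightarrow> space3 \<Rightarrow> real" where
  "iter_partial [] f = f"
| "iter_partial (i # is) f = partial i (iter_partial is f)"

text \<open>Differentiability of every iterated partial derivative makes all of them continuous,
  so this is \<open>C\<^sup>\<infinity>\<close> on the whole space.\<close>

definition smooth :: "(space3 \<Rightarrow> real) \<Rightarrow> bool" where
  "smooth f \<longleftrightarrow> (\<forall>is x. iter_partial is f differentiable (at x))"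

text \<open>Locally \<open>\<Omega>\<close> is the sublevel set of a smooth function with nonvanishing gradient. Since the
  condition is local, it is no restriction that \<open>\<rho>\<close> is defined on the whole space.\<close>

definition smooth_boundary :: "space3 set \<Rightarrow> bool" where
  "smooth_boundary \<Omega> \<longleftrightarrow>
     (\<forall>x \<in> frontier \<Omega>. \<exists>U \<rho>. open U \<and> x \<in> U \<and> smooth \<rho> \<and> (\<exists>i. partial i \<rho> x \<noteq> 0) \<and>
        \<Omega> \<inter> U = {y \<in> U. \<rho> y < 0})"

section \<open>Lebesgue and Sobolev spaces\<close>

text \<open>Elements of \<open>L\<^sup>2(\<Omega>)\<close> and \<open>H\<^sup>1(\<Omega>)\<close> are represented by functions on the whole space, whose
  values outside \<open>\<Omega>\<close> are irrelevant.\<close>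

definition L2 :: "space3 set \<Rightarrow> (space3 \<Rightarrow> real) set" where
  "L2 \<Omega> = {f. f \<in> borel_measurable (lebesgue_on \<Omega>) \<and>
               integrable (lebesgue_on \<Omega>) (\<lambda>x. (f x)\<^sup>2)}"

definition l2_inner :: "space3 set \<Rightarrow> (space3 \<Rightarrow> real) \<Rightarrow> (space3 \<Rightarrow> real) \<Rightarrow> real" where
  "l2_inner \<Omega> u v = (LINT x|lebesgue_on \<Omega>. u x * v x)"

definition l2_norm :: "space3 set \<Rightarrow> (space3 \<Rightarrow> real) \<Rightarrow> real" where
  "l2_norm \<Omega> u = sqrt (LINT x|lebesgue_on \<Omega>. \<bar>u x\<bar>\<^sup>2)"

definition test_fun :: "space3 set \<Rightarrow> (space3 \<Rightarrow> real) set" where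
  "test_fun \<Omega> = {\<psi>. smooth \<psi> \<and> compact (closure {x. \<psi> x \<noteq> 0}) \<and> closure {x. \<psi> x \<noteq> 0} \<subseteq> \<Omega>}"

definition is_weak_grad :: "space3 set \<Rightarrow> (space3 \<Rightarrow> real) \<Rightarrow> (space3 \<Rightarrow> space3) \<Rightarrow> bool" where
  "is_weak_grad \<Omega> u g \<longleftrightarrow>
     (\<forall>i. (\<lambda>x. g x $ i) \<in> L2 \<Omega>) \<and>
     (\<forall>\<psi> \<in> test_fun \<Omega>. \<forall>i.
        (LINT x|lebesgue_on \<Omega>. u x * partial i \<psi> x) = - (LINT x|lebesgue_on \<Omega>. g x $ i * \<psi> x))"

definition H1 :: "space3 set \<Rightarrow> (space3 \<Rightarrow> real) set" where
  "H1 \<Omega> = {u \<in> L2 \<Omega>. \<exists>g. is_weak_grad \<Omega> u g}"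

text \<open>The weak gradient is unique up to null sets; only integrals of it are used below.\<close>

definition wgrad :: "space3 set \<Rightarrow> (space3 \<Rightarrow> real) \<Rightarrow> space3 \<Rightarrow> space3" where
  "wgrad \<Omega> u = (SOME g. is_weak_grad \<Omega> u g)"

definition grad_inner :: "space3 set \<Rightarrow> (space3 \<Rightarrow> real) \<Rightarrow> (space3 \<Rightarrow> real) \<Rightarrow> real" where
  "grad_inner \<Omega> u v = (LINT x|lebesgue_on \<Omega>. wgrad \<Omega> u x \<bullet> wgrad \<Omega> v x)"

definition h1_norm :: "space3 set \<Rightarrow> (space3 \<Rightarrow> real) \<Rightarrow> real" where
  "h1_norm \<Omega> u = sqrt ((l2_norm \<Omega> u)\<^sup>2 + grad_inner \<Omega> u u)"

definition H10 :: "space3 set \<Rightarrow> (space3 \<Rightarrow> real) set" where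
  "H10 \<Omega> = {u \<in> H1 \<Omega>. \<exists>\<psi> :: nat \<Rightarrow> space3 \<Rightarrow> real.
     (\<forall>k. \<psi> k \<in> test_fun \<Omega>) \<and> (\<lambda>k. h1_norm \<Omega> (\<lambda>x. u x - \<psi> k x)) \<longlonglongrightarrow> 0}"

section \<open>Triangulations and finite elements\<close>

text \<open>A face-to-face mesh of tetrahedra for a convex domain with curved boundary: the union of
  the tetrahedra determines a polyhedral domain inside \<open>\<Omega>\<close> whose boundary vertices lie on the
  boundary of \<open>\<Omega>\<close>.\<close>

definition triangulation_of :: "space3 set \<Rightarrow> space3 set set \<Rightarrow> bool" where
  "triangulation_of \<Omega> \<T> \<longleftrightarrow>
     triangulation \<T> \<and> \<T> \<noteq> {} \<and> (\<forall>K \<in> \<T>. 3 simplex K) \<and>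
     \<Union>\<T> \<subseteq> closure \<Omega> \<and> connected (interior (\<Union>\<T>)) \<and>
     (\<forall>K \<in> \<T>. \<forall>p. p extreme_point_of K \<and> p \<in> frontier (\<Union>\<T>) \<longrightarrow> p \<in> frontier \<Omega>)"

definition mesh_size :: "space3 set set \<Rightarrow> real" where
  "mesh_size \<T> = Max (diameter ` \<T>)"

definition inradius :: "space3 set \<Rightarrow> real" where
  "inradius K = Sup {r. 0 \<le> r \<and> (\<exists>x. cball x r \<subseteq> K)}"

text \<open>Shape regularity and quasi-uniformity are properties of a family of meshes, here indexed by
  the set \<open>H\<close> of mesh sizes: the constants do not depend on \<open>h\<close>.\<close>

definition shape_regular :: "real set \<Rightarrow> (real \<Rightarrow> space3 set set) \<Rightarrow> bool" where
  "shape_regular H \<T> \<longleftrightarrow> (\<exists>\<sigma>>0. \<forall>h \<in> H. \<forall>K \<in> \<T> h. diameter K \<le> \<sigma> * inradius K)"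

definition quasi_uniform :: "real set \<Rightarrow> (real \<Rightarrow> space3 set set) \<Rightarrow> bool" where
  "quasi_uniform H \<T> \<longleftrightarrow> (\<exists>c>0. \<forall>h \<in> H. \<forall>K \<in> \<T> h. c * mesh_size (\<T> h) \<le> diameter K)"

text \<open>Functions in the finite element space are extended by zero outside the mesh; by continuity
  they vanish on the boundary of the polyhedral domain.\<close>

definition fe_space :: "space3 set set \<Rightarrow> (space3 \<Rightarrow> real) set" where
  "fe_space \<T> = {v. continuous_on UNIV v \<and>
     (\<forall>K \<in> \<T>. \<exists>a b. \<forall>x \<in> K. v x = a \<bullet> x + b) \<and> (\<forall>x. x \<notin> \<Union>\<T> \<longrightarrow> v x = 0)}"

definition ritz :: "space3 set \<Rightarrow> (space3 \<Rightarrow> real) set \<Rightarrow> (space3 \<Rightarrow> real) \<Rightarrow> space3 \<Rightarrow> real" where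
  "ritz \<Omega> S u = (THE w. w \<in> S \<and> (\<forall>v \<in> S. grad_inner \<Omega> w v = grad_inner \<Omega> u v))"

section \<open>The fully discrete scheme\<close>

definition mu :: "space3 set \<Rightarrow> (space3 \<Rightarrow> real) \<Rightarrow> real \<Rightarrow> (space3 \<Rightarrow> real) \<Rightarrow> real" where
  "mu \<Omega> V \<beta> v = 1 / (l2_norm \<Omega> v)\<^sup>2 *
     (LINT x|lebesgue_on \<Omega>. (norm (wgrad \<Omega> v x))\<^sup>2 + V x * \<bar>v x\<bar>\<^sup>2 + \<beta> * \<bar>v x\<bar> ^ 4)"

definition normalized :: "space3 set \<Rightarrow> (space3 \<Rightarrow> real) \<Rightarrow> space3 \<Rightarrow> real" where
  "normalized \<Omega> v = (\<lambda>x. v x / l2_norm \<Omega> v)"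

definition scheme_step ::
  "space3 set \<Rightarrow> (space3 \<Rightarrow> real) \<Rightarrow> real \<Rightarrow> (space3 \<Rightarrow> real) set \<Rightarrow> real \<Rightarrow>
   (space3 \<Rightarrow> real) \<Rightarrow> (space3 \<Rightarrow> real) \<Rightarrow> bool" where
  "scheme_step \<Omega> V \<beta> S \<tau> \<phi> w \<longleftrightarrow> w \<in> S \<and>
     (\<forall>v \<in> S.
        l2_inner \<Omega> (\<lambda>x. (w x - \<phi> x) / \<tau>) v + grad_inner \<Omega> w v =
          - l2_inner \<Omega> (\<lambda>x. V x * \<phi> x) v
          - \<beta> * l2_inner \<Omega> (\<lambda>x. \<bar>\<phi> x\<bar>\<^sup>2 * \<phi> x) v
          + mu \<Omega> V \<beta> \<phi> * l2_inner \<Omega> \<phi> v)"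

definition step_solution ::
  "space3 set \<Rightarrow> (space3 \<Rightarrow> real) \<Rightarrow> real \<Rightarrow> (space3 \<Rightarrow> real) set \<Rightarrow> real \<Rightarrow>
   (space3 \<Rightarrow> real) \<Rightarrow> space3 \<Rightarrow> real" where
  "step_solution \<Omega> V \<beta> S \<tau> \<phi> = (THE w. scheme_step \<Omega> V \<beta> S \<tau> \<phi> w)"

primrec iterate ::
  "space3 set \<Rightarrow> (space3 \<Rightarrow> real) \<Rightarrow> real \<Rightarrow> (space3 \<Rightarrow> real) set \<Rightarrow> real \<Rightarrow>
   (space3 \<Rightarrow> real) \<Rightarrow> nat \<Rightarrow> space3 \<Rightarrow> real" where
  "iterate \<Omega> V \<beta> S \<tau> \<phi>0 0 = normalized \<Omega> (ritz \<Omega> S \<phi>0)"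
| "iterate \<Omega> V \<beta> S \<tau> \<phi>0 (Suc n) =
     normalized \<Omega> (step_solution \<Omega> V \<beta> S \<tau> (iterate \<Omega> V \<beta> S \<tau> \<phi>0 n))"

end

theory Submission
  imports Defs
begin

text \<open>
  One step of the scheme is a linear system on the finite-dimensional space \<open>S\<^sub>h\<close> with the bilinear
  form \<open>(w, v) / \<tau> + (\<nabla>w, \<nabla>v)\<close>, which is positive definite; hence it has a unique solution. If that
  solution vanished, testing with \<open>\<phi>\<^sub>h\<^sup>n\<close> would give \<open>- \<parallel>\<phi>\<^sub>h\<^sup>n\<parallel>\<^sup>2 / \<tau> = \<parallel>\<nabla>\<phi>\<^sub>h\<^sup>n\<parallel>\<^sup>2\<close> by the choice of \<open>\<mu>\<close>,
  contradicting \<open>\<parallel>\<phi>\<^sub>h\<^sup>n\<parallel> = 1\<close>.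

  Bilinearity of \<open>(\<nabla>w, \<nabla>v)\<close> rests on the almost everywhere uniqueness of weak gradients. The piecewise
  gradient of a finite element function \<open>v\<close> is its weak gradient: pass to the limit in \<open>\<integral> (D\<^sub>t v) \<psi> = \<integral> v (D\<^bsub>-t\<^esub> \<psi>)\<close> for difference quotients \<open>D\<^sub>t\<close>, which
  is justified by dominated convergence because \<open>v\<close> is Lipschitz.
\<close>

section \<open>Smooth bump functions\<close>

text \<open>The polynomial factor makes this class of functions closed under differentiation.\<close>

definition bump_poly :: "real poly \<Rightarrow> real \<Rightarrow> real" where
  "bump_poly p t = (if t > 0 then poly p (1 / t) * exp (- (1 / t)) else 0)"

lemma poly_mult_exp_minus_tendsto_0:
  fixes p :: "real poly"
  shows "((\<lambda>s. poly p s * exp (- s)) \<longlongrightarrow> 0) at_top"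
proof -
  have "((\<lambda>s. \<Sum>i\<le>degree p. coeff p i * (s ^ i / exp s)) \<longlongrightarrow> (\<Sum>i\<le>degree p. coeff p i * 0)) at_top"
    by (intro tendsto_intros tendsto_power_div_exp_0)
  then show ?thesis
    by (simp add: poly_altdef exp_minus sum_distrib_right divide_inverse mult.assoc)
qed

text \<open>Only the right-hand limit has content: there 1/t tends to infinity, where the
  exponential beats every polynomial.\<close>

lemma bump_poly_tendsto_0: "(bump_poly p \<longlongrightarrow> 0) (at 0)"
proof -
  have "((\<lambda>t. poly p (inverse t) * exp (- inverse t)) \<longlongrightarrow> 0) (at_right 0)"
    using filterlim_compose[OF poly_mult_exp_minus_tendsto_0 filterlim_inverse_at_top_right] .
  then have "(bump_poly p \<longlongrightarrow> 0) (at_right 0)"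
    by (rule tendsto_cong[THEN iffD1, rotated])
       (auto simp: bump_poly_def eventually_at_filter inverse_eq_divide)
  moreover have "(bump_poly p \<longlongrightarrow> 0) (at_left 0)"
    by (rule tendsto_eventually) (auto simp: bump_poly_def eventually_at_filter)
  ultimately show ?thesis
    by (simp add: filterlim_split_at_real)
qed

text \<open>In terms of s = 1/t, the chain rule contributes the factor -s^2 and the product rule p'
  - p, whence the polynomial s^2 (p - p').\<close>

lemma bump_poly_has_real_derivative:
  "(bump_poly p has_real_derivative bump_poly ([:0, 0, 1:] * (p - pderiv p)) t) (at t)"
proof -
  consider "t > 0" | "t < 0" | "t = 0" by linarith
  then show ?thesis
  proof cases
    case 1
    have "((\<lambda>t. poly p (1 / t) * exp (- (1 / t))) has_real_derivative
        bump_poly ([:0, 0, 1:] * (p - pderiv p)) t) (at t)"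
      using 1
      by (auto intro!: derivative_eq_intros DERIV_chain2[OF poly_DERIV]
          simp: bump_poly_def field_simps power2_eq_square)
    moreover have "\<forall>\<^sub>F s in nhds t. poly p (1 / s) * exp (- (1 / s)) = bump_poly p s"
      using eventually_nhds_in_open[of "{0<..}" t] 1
      by (auto simp: bump_poly_def elim!: eventually_mono)
    ultimately show ?thesis
      by (subst (asm) DERIV_cong_ev[OF refl _ refl])
  next
    case 2
    have "((\<lambda>t. 0) has_real_derivative bump_poly ([:0, 0, 1:] * (p - pderiv p)) t) (at t)"
      using 2 by (auto simp: bump_poly_def)
    moreover have "\<forall>\<^sub>F s in nhds t. 0 = bump_poly p s"
      using eventually_nhds_in_open[of "{..<0}" t] 2
      by (auto simp: bump_poly_def elim!: eventually_mono)
    ultimately show ?thesis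
      by (subst (asm) DERIV_cong_ev[OF refl _ refl])
  next
    case 3
    \<comment> \<open>Dividing by \<open>h\<close> multiplies by 1/h, which shifts the coefficients
      of \<open>p\<close>. So the difference quotient at 0 is itself a bump, and its limit is
      already known.\<close>
    have "bump_poly p (0 + h) / h = bump_poly (pCons 0 p) h" for h
      by (auto simp: bump_poly_def)
    then show ?thesis
      using bump_poly_tendsto_0[of "pCons 0 p"] 3
      by (simp add: DERIV_def bump_poly_def[of _ 0])
  qed
qed

text \<open>\<open>smooth\<close> asks for differentiability of every iterated partial derivative. A
  class of differentiable functions closed under partial derivatives yields this by induction on the
  list of directions.\<close>

inductive_set bump_algebra :: "(space3 \<Rightarrow> real) set" where
  const: "(\<lambda>x. c) \<in> bump_algebra"
| bump: "(\<lambda>x. bump_poly p (a \<bullet> x + b)) \<in> bump_algebra"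
| add: "f \<in> bump_algebra \<Longrightarrow> g \<in> bump_algebra \<Longrightarrow> (\<lambda>x. f x + g x) \<in> bump_algebra"
| mult: "f \<in> bump_algebra \<Longrightarrow> g \<in> bump_algebra \<Longrightarrow> (\<lambda>x. f x * g x) \<in> bump_algebra"

lemma partial_eqI: "(f has_derivative f') (at x) \<Longrightarrow> partial i f x = f' (axis i 1)"
  unfolding partial_def using frechet_derivative_at by metis

lemma bump_algebra_partial:
  assumes "f \<in> bump_algebra"
  shows "(\<forall>x. f differentiable at x) \<and> (\<forall>i. partial i f \<in> bump_algebra)"
  using assms
proof induction
  case (const c)
  have "partial i (\<lambda>x. c) = (\<lambda>x. 0)" for i
    by (rule ext) (auto intro!: partial_eqI[THEN trans] derivative_intros)
  then show ?case
    by (auto intro: bump_algebra.const)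
next
  case (bump p a b)
  let ?q = "[:0, 0, 1:] * (p - pderiv p)"
  have D: "((\<lambda>x. bump_poly p (a \<bullet> x + b)) has_derivative
      (\<lambda>h. bump_poly ?q (a \<bullet> x + b) * (a \<bullet> h))) (at x)" for x
    by (rule has_derivative_compose[OF _ bump_poly_has_real_derivative[unfolded has_field_derivative_def]])
       (auto intro!: derivative_eq_intros)
  have "partial i (\<lambda>x. bump_poly p (a \<bullet> x + b)) =
      (\<lambda>x. bump_poly ?q (a \<bullet> x + b) * (a \<bullet> axis i 1))" for i
    by (rule ext) (rule partial_eqI[OF D])
  moreover have "(\<lambda>x. bump_poly ?q (a \<bullet> x + b) * (a \<bullet> axis i 1)) \<in> bump_algebra" for i
    by (intro bump_algebra.intros)
  ultimately show ?case
    using D by (auto simp: differentiable_def)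
next
  case (add f g)
  have "partial i (\<lambda>x. f x + g x) = (\<lambda>x. partial i f x + partial i g x)" for i
  proof
    fix x
    show "partial i (\<lambda>x. f x + g x) x = partial i f x + partial i g x"
      unfolding partial_def[of i f] partial_def[of i g]
      using add.IH
      by (intro partial_eqI[THEN trans[OF _ refl]] has_derivative_add)
         (auto simp: frechet_derivative_works[symmetric])
  qed
  with add show ?case
    by (auto intro: bump_algebra.add)
next
  case (mult f g)
  have "partial i (\<lambda>x. f x * g x) = (\<lambda>x. f x * partial i g x + partial i f x * g x)" for i
  proof
    fix x
    show "partial i (\<lambda>x. f x * g x) x = f x * partial i g x + partial i f x * g x"
      unfolding partial_def[of i f] partial_def[of i g]
      using mult.IH
      by (intro partial_eqI[THEN trans[OF _ refl]] has_derivative_mult)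
         (auto simp: frechet_derivative_works[symmetric])
  qed
  with mult show ?case
    by (auto intro!: bump_algebra.add bump_algebra.mult)
qed

lemma bump_algebra_smooth:
  assumes "f \<in> bump_algebra"
  shows "smooth f"
proof -
  have "iter_partial is f \<in> bump_algebra" for "is"
    using assms bump_algebra_partial by (induction "is") auto
  then show ?thesis
    using bump_algebra_partial by (auto simp: smooth_def)
qed

text \<open>There is one factor for each of the six faces of the box, flat to infinite order at that
  face. The parameter \<open>k\<close> steepens the profile, so that \<open>k\<close> to infinity
  recovers the indicator of the open box.\<close>

definition box_bump :: "space3 \<Rightarrow> space3 \<Rightarrow> real \<Rightarrow> space3 \<Rightarrow> real" where
  "box_bump a b k x = (\<Prod>i\<in>UNIV. bump_poly 1 (k * (x $ i - a $ i)) * bump_poly 1 (k * (b $ i - x $ i)))"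

lemma box_bump_in_bump_algebra: "box_bump a b k \<in> bump_algebra"
proof -
  have *: "(\<lambda>x. bump_poly 1 (k * (x $ i - a $ i))) \<in> bump_algebra"
       "(\<lambda>x. bump_poly 1 (k * (b $ i - x $ i))) \<in> bump_algebra" for i
    using bump_algebra.bump[of 1 "axis i k" "- k * a $ i"] bump_algebra.bump[of 1 "axis i (-k)" "k * b $ i"]
    by (simp_all add: inner_axis' algebra_simps)
  have "(\<lambda>x. \<Prod>i\<in>I. bump_poly 1 (k * (x $ i - a $ i)) * bump_poly 1 (k * (b $ i - x $ i))) \<in> bump_algebra"
    if "finite I" for I :: "3 set"
    using that by induction (auto intro!: bump_algebra.const bump_algebra.mult *)
  then show ?thesis
    by (simp add: box_bump_def[abs_def])
qed

lemma bump_poly_1_bounds: "0 \<le> bump_poly 1 t" "bump_poly 1 t \<le> 1"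
  by (auto simp: bump_poly_def)

lemma box_bump_bounds: "0 \<le> box_bump a b k x" "box_bump a b k x \<le> 1"
  unfolding box_bump_def
  by (auto intro!: prod_nonneg prod_le_1 mult_nonneg_nonneg mult_le_one bump_poly_1_bounds)

lemma box_bump_eq_0:
  assumes "x \<notin> box a b" "k > 0"
  shows "box_bump a b k x = 0"
proof -
  obtain i where "x $ i \<le> a $ i \<or> b $ i \<le> x $ i"
    using assms by (auto simp: mem_box_cart not_less)
  then show ?thesis
    using assms(2) unfolding box_bump_def
    by (intro prod_zero bexI[of _ i]) (auto simp: bump_poly_def zero_less_mult_iff)
qed

lemma box_bump_test_fun:
  assumes "cbox a b \<subseteq> \<Omega>" "k > 0"
  shows "box_bump a b k \<in> test_fun \<Omega>"
proof -
  have "{x. box_bump a b k x \<noteq> 0} \<subseteq> cbox a b"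
    using box_bump_eq_0[OF _ assms(2)] box_subset_cbox by blast
  then have sub: "closure {x. box_bump a b k x \<noteq> 0} \<subseteq> cbox a b"
    by (rule closure_minimal) (rule closed_cbox)
  then have "compact (closure {x. box_bump a b k x \<noteq> 0})"
    by (metis bounded_cbox bounded_subset closed_closure compact_eq_bounded_closed)
  then show ?thesis
    using sub assms bump_algebra_smooth[OF box_bump_in_bump_algebra]
    by (auto simp: test_fun_def)
qed

lemma bump_poly_1_tendsto_1:
  assumes "t > 0"
  shows "(\<lambda>k. bump_poly 1 (real (Suc k) * t)) \<longlonglongrightarrow> 1"
proof -
  have "(\<lambda>k. exp (- (inverse (real (Suc k)) * (1 / t)))) \<longlonglongrightarrow> exp (- (0 * (1 / t)))"
    by (intro tendsto_intros LIMSEQ_inverse_real_of_nat)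
  moreover have "exp (- (inverse (real (Suc k)) * (1 / t))) = bump_poly 1 (real (Suc k) * t)" for k
    using assms by (auto simp: bump_poly_def divide_simps zero_less_mult_iff)
  ultimately show ?thesis by simp
qed

lemma box_bump_tendsto_indicator:
  "(\<lambda>k. box_bump a b (real (Suc k)) x) \<longlonglongrightarrow> indicator (box a b) x"
proof (cases "x \<in> box a b")
  case True
  then have "(\<lambda>k. box_bump a b (real (Suc k)) x) \<longlonglongrightarrow> (\<Prod>i\<in>(UNIV :: 3 set). 1 * 1)"
    unfolding box_bump_def
    by (intro tendsto_intros bump_poly_1_tendsto_1) (auto simp: mem_box_cart)
  with True show ?thesis by simp
next
  case False
  then show ?thesis by (simp add: box_bump_eq_0 del: of_nat_Suc)
qed

section \<open>The fundamental lemma of the calculus of variations\<close>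

text \<open>Open boxes are stable under intersection and generate the Borel sets, so a pi-lambda
  argument extends the vanishing to all Borel sets; a density all of whose set integrals vanish is
  zero almost everywhere.\<close>

lemma AE_zero_if_box_integrals_zero:
  fixes f :: "'a::euclidean_space \<Rightarrow> real"
  assumes f: "integrable lborel f"
    and box: "\<And>a b. (LINT x:box a b|lborel. f x) = 0"
  shows "AE x in lborel. f x = 0"
proof -
  have setf: "set_integrable lborel A f" if "A \<in> sets borel" for A
    using f that unfolding set_integrable_def by (intro integrable_mult_indicator) auto
  \<comment> \<open>The complement case below needs the integral over the whole space, obtained by
    exhausting it with boxes.\<close>
  have "incseq (\<lambda>n. box (- (real n *\<^sub>R One)) (real n *\<^sub>R One) :: 'a set)"
    by (auto simp: incseq_def box_def)
  then have "(\<lambda>n. LINT x:box (- (real n *\<^sub>R One)) (real n *\<^sub>R One)|lborel. f x)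
      \<longlonglongrightarrow> (LINT x:(\<Union>n::nat. box (- (real n *\<^sub>R One)) (real n *\<^sub>R One))|lborel. f x)"
    by (intro set_integral_cont_up setf) auto
  then have UNIV0: "(LINT x:UNIV|lborel. f x) = 0"
    by (simp add: box UN_box_eq_UNIV LIMSEQ_const_iff)
  have zero: "(LINT x:A|lborel. f x) = 0" if A: "A \<in> sets borel" for A
  proof -
    have "Int_stable (range (\<lambda>(a, b). box a b :: 'a set))"
      by (auto simp: Int_stable_def box_Int_box)
    moreover have "range (\<lambda>(a, b). box a b :: 'a set) \<subseteq> Pow UNIV"
      by auto
    moreover have "A \<in> sigma_sets UNIV (range (\<lambda>(a, b). box a b))"
      using A unfolding borel_eq_box by simp
    ultimately show ?thesis
    proof (induction rule: sigma_sets_induct_disjoint)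
      case (basic A)
      then show ?case using box by auto
    next
      case empty
      show ?case by (simp add: set_lebesgue_integral_def)
    next
      case (compl A)
      then have "A \<in> sets borel"
        unfolding borel_eq_box by simp
      then have "(LINT x:A \<union> (UNIV - A)|lborel. f x) =
          (LINT x:A|lborel. f x) + (LINT x:UNIV - A|lborel. f x)"
        by (intro set_integral_Un setf) auto
      with compl UNIV0 show ?case by simp
    next
      case (union A)
      then have "A i \<in> sets borel" for i
        unfolding borel_eq_box by auto
      moreover have "A i \<inter> A j = {}" if "i \<noteq> j" for i j
        using union that by (auto simp: disjoint_family_on_def)
      ultimately have "(LINT x:(\<Union>i. A i)|lborel. f x) = (\<Sum>i. (LINT x:(A i)|lborel. f x))"
        by (intro lebesgue_integral_countable_add setf) auto
      with union show ?case by simp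
    qed
  qed
  show ?thesis
    by (rule density_unique_real[OF f, of "\<lambda>_. 0"]) (auto simp: zero)
qed

text \<open>Bumps converge boundedly to box indicators, so dominated convergence makes the integral
  vanish over every box whose closure lies in \<open>\<Omega>\<close>; countably many such boxes
  cover \<open>\<Omega>\<close>.\<close>

lemma fundamental_lemma_calculus_of_variations:
  assumes "open \<Omega>" and f: "integrable (lebesgue_on \<Omega>) f"
    and test: "\<And>\<psi>. \<psi> \<in> test_fun \<Omega> \<Longrightarrow> (LINT x|lebesgue_on \<Omega>. f x * \<psi> x) = 0"
  shows "AE x in lebesgue_on \<Omega>. f x = 0"
proof -
  have \<Omega>: "\<Omega> \<inter> space lebesgue \<in> sets lebesgue"
    using \<open>open \<Omega>\<close> by (simp add: borel_open)
  \<comment> \<open>Extension by zero and a Borel representative \<open>f'\<close> move the problem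
    to \<open>lborel\<close>, where the statement about boxes applies.\<close>
  define F where "F x = indicator \<Omega> x *\<^sub>R f x" for x
  have F: "integrable lebesgue F"
    using f unfolding F_def by (subst (asm) integrable_restrict_space[OF \<Omega>])
  then have "F \<in> borel_measurable lebesgue" by auto
  from completion_ex_borel_measurable_real[OF this] obtain f'
    where f'_meas[measurable]: "f' \<in> borel_measurable lborel" and eq: "AE x in lborel. F x = f' x"
    by blast
  have eq': "AE x in lebesgue. F x = f' x"
    using eq by (rule AE_completion)
  have "integrable lebesgue f'"
    using F eq' by (subst integrable_cong_AE[symmetric, of F]) (auto intro: measurable_completion)
  then have f': "integrable lborel f'"
    by (subst (asm) integrable_completion) auto
  have box0: "(LINT x:box a b|lborel. f' x) = 0" if "cbox a b \<subseteq> \<Omega>" for a b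
  proof -
    let ?\<psi> = "\<lambda>k. box_bump a b (real (Suc k))"
    have cont: "continuous_on UNIV (box_bump a b k)" for k
      using bump_algebra_partial[OF box_bump_in_bump_algebra]
      by (auto intro!: continuous_at_imp_continuous_on differentiable_imp_continuous_within)
    have [measurable]: "box_bump a b k \<in> borel_measurable borel" for k
      using cont by (rule borel_measurable_continuous_onI)
    have "(LINT x|lborel. f' x * ?\<psi> k x) = 0" for k
    proof -
      have \<psi>: "?\<psi> k \<in> borel_measurable lebesgue"
        by (intro measurable_completion) measurable
      have "(LINT x|lborel. f' x * ?\<psi> k x) = (LINT x|lebesgue. f' x * ?\<psi> k x)"
        by (rule integral_completion[symmetric]) measurable
      also have "\<dots> = (LINT x|lebesgue. F x * ?\<psi> k x)"
        using eq' \<psi> F f'_meas by (intro integral_cong_AE borel_measurable_times) (auto intro: measurable_completion)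
      also have "\<dots> = (LINT x|lebesgue_on \<Omega>. f x * ?\<psi> k x)"
        by (subst integral_restrict_space[OF \<Omega>]) (simp add: F_def mult.assoc)
      also have "\<dots> = 0"
        by (intro test box_bump_test_fun that) simp
      finally show ?thesis .
    qed
    moreover have "(\<lambda>k. LINT x|lborel. f' x * ?\<psi> k x) \<longlonglongrightarrow> (LINT x|lborel. f' x * indicator (box a b) x)"
    proof (rule integral_dominated_convergence[where w = "\<lambda>x. \<bar>f' x\<bar>"])
      show "AE x in lborel. norm (f' x * ?\<psi> k x) \<le> \<bar>f' x\<bar>" for k
        using box_bump_bounds[of a b "real (Suc k)"] by (auto simp: abs_mult intro!: mult_left_le)
      show "AE x in lborel. (\<lambda>k. f' x * ?\<psi> k x) \<longlonglongrightarrow> f' x * indicator (box a b) x"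
        by (intro AE_I2 tendsto_mult tendsto_const box_bump_tendsto_indicator)
    qed (use f' in auto)
    ultimately show ?thesis
      by (simp add: LIMSEQ_const_iff set_lebesgue_integral_def mult.commute)
  qed
  \<comment> \<open>Boxes reaching out of \<open>\<Omega>\<close> are not covered by
    \<open>box0\<close>. Cutting \<open>f'\<close> off to \<open>box c d\<close> replaces every test
    box by its intersection with \<open>box c d\<close>.\<close>
  have AE_box: "AE x in lborel. x \<in> box c d \<longrightarrow> f' x = 0" if "cbox c d \<subseteq> \<Omega>" for c d
  proof -
    have "AE x in lborel. indicator (box c d) x * f' x = 0"
    proof (rule AE_zero_if_box_integrals_zero)
      show "integrable lborel (\<lambda>x. indicator (box c d) x * f' x)"
        using integrable_mult_indicator[OF _ f', of "box c d"] by simp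
      show "(LINT x:box a b|lborel. indicator (box c d) x * f' x) = 0" for a b
      proof -
        obtain l u where lu: "box a b \<inter> box c d = box l u"
          by (auto simp: box_Int_box)
        have eq: "(LINT x:box a b|lborel. indicator (box c d) x * f' x) = (LINT x:box l u|lborel. f' x)"
          unfolding set_lebesgue_integral_def lu[symmetric]
          by (intro Bochner_Integration.integral_cong) (auto split: split_indicator)
        show ?thesis
        \<comment> \<open>An empty open box says nothing about where its corners lie. Only in the
          nonempty case is \<open>cbox l u\<close> the closure of \<open>box l u\<close> and hence
          inside \<open>\<Omega>\<close>.\<close>
        proof (cases "box l u = {}")
          case True
          then show ?thesis unfolding eq by (simp add: set_lebesgue_integral_def)
        next
          case False
          have "closure (box l u) \<subseteq> cbox c d"
            using lu by (intro closure_minimal closed_cbox) (use box_subset_cbox in blast)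
          then have "cbox l u \<subseteq> \<Omega>"
            using that False by (simp add: closure_box)
          then show ?thesis unfolding eq by (rule box0)
        qed
      qed
    qed
    then show ?thesis by (auto elim!: eventually_mono)
  qed
  obtain \<D> where \<D>: "countable \<D>" "\<D> \<subseteq> Pow \<Omega>" "\<And>X. X \<in> \<D> \<Longrightarrow> \<exists>a b. X = cbox a b" "\<Union>\<D> = \<Omega>"
    using open_countable_Union_open_cbox[OF \<open>open \<Omega>\<close>] by blast
  have "AE x in lebesgue. x \<in> X \<longrightarrow> f' x = 0" if X: "X \<in> \<D>" for X
  proof -
    obtain c d where cd: "X = cbox c d" "cbox c d \<subseteq> \<Omega>"
      using \<D> X by blast
    \<comment> \<open>The cover consists of closed boxes while \<open>f'\<close> is known to vanish
      on open ones; the faces in between are null.\<close>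
    have "cbox c d - box c d \<in> null_sets lebesgue"
      using negligible_frontier_interval negligible_iff_null_sets by blast
    then have "AE x in lebesgue. x \<notin> cbox c d - box c d"
      by (rule AE_not_in)
    moreover have "AE x in lebesgue. x \<in> box c d \<longrightarrow> f' x = 0"
      using AE_box[OF cd(2)] by (rule AE_completion)
    ultimately show ?thesis
      unfolding cd(1) by eventually_elim auto
  qed
  then have "AE x in lebesgue. \<forall>X\<in>\<D>. x \<in> X \<longrightarrow> f' x = 0"
    by (subst AE_ball_countable[OF \<D>(1)]) blast
  with eq' have "AE x in lebesgue. x \<in> \<Omega> \<longrightarrow> f x = 0"
  proof eventually_elim
    case (elim x)
    show ?case
    proof
      assume "x \<in> \<Omega>"
      with elim \<D>(4) have "f' x = 0" by blast
      with elim \<open>x \<in> \<Omega>\<close> show "f x = 0" by (simp add: F_def)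
    qed
  qed
  then show ?thesis
    by (simp add: AE_restrict_space_iff[OF \<Omega>])
qed

section \<open>Weak gradients\<close>

locale bounded_domain =
  fixes \<Omega> :: "space3 set"
  assumes open_domain: "open \<Omega>" and bounded_domain: "bounded \<Omega>"
begin

abbreviation "M \<equiv> lebesgue_on \<Omega>"

lemma domain_sets: "\<Omega> \<inter> space lebesgue \<in> sets lebesgue"
  using open_domain by (simp add: borel_open)

lemma finite_measure_domain: "finite_measure M"
proof
  have "\<Omega> \<in> lmeasurable"
    using open_domain bounded_domain by (simp add: lmeasurable_open)
  then show "emeasure M (space M) \<noteq> \<infinity>"
    using fmeasurableD2[of \<Omega> lebesgue] fmeasurableD[of \<Omega> lebesgue]
    by (simp add: emeasure_restrict_space del: emeasure_completion)
qed

lemma continuous_on_measurable_domain: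
  fixes f :: "space3 \<Rightarrow> real"
  assumes "continuous_on UNIV f"
  shows "f \<in> borel_measurable M"
  using assms
  by (intro measurable_restrict_space1 measurable_completion)
     (simp add: borel_measurable_continuous_onI)

text \<open>A bridge from the integrals over \<open>\<Omega>\<close> in the weak formulation to
  integrals over the whole space, where translation invariance is available.\<close>

lemma integral_domain_eq_lborel:
  fixes f :: "space3 \<Rightarrow> real"
  assumes f: "f \<in> borel_measurable borel" and zero: "\<And>x. x \<notin> \<Omega> \<Longrightarrow> f x = 0"
  shows "(LINT x|M. f x) = (LINT x|lborel. f x)"
proof -
  have "(LINT x|M. f x) = (LINT x|lebesgue. indicator \<Omega> x *\<^sub>R f x)"
    by (rule integral_restrict_space[OF domain_sets])
  also have "(\<lambda>x. indicator \<Omega> x *\<^sub>R f x) = f"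
    using zero by (auto simp: fun_eq_iff indicator_def)
  also have "integral\<^sup>L lebesgue f = (LINT x|lborel. f x)"
    by (rule integral_completion) (use f in simp)
  finally show ?thesis .
qed

lemma L2_measurable: "f \<in> L2 \<Omega> \<Longrightarrow> f \<in> borel_measurable M"
  by (simp add: L2_def)

lemma L2_mult_integrable:
  assumes "f \<in> L2 \<Omega>" "g \<in> L2 \<Omega>"
  shows "integrable M (\<lambda>x. f x * g x)"
proof (rule Bochner_Integration.integrable_bound)
  show "integrable M (\<lambda>x. (f x)\<^sup>2 + (g x)\<^sup>2)"
    using assms by (auto simp: L2_def)
  show "AE x in M. norm (f x * g x) \<le> norm ((f x)\<^sup>2 + (g x)\<^sup>2)"
  proof (rule AE_I2)
    fix x
    show "norm (f x * g x) \<le> norm ((f x)\<^sup>2 + (g x)\<^sup>2)"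
      using sum_squares_bound[of "\<bar>f x\<bar>" "\<bar>g x\<bar>"] mult_nonneg_nonneg[of "\<bar>f x\<bar>" "\<bar>g x\<bar>"]
      unfolding real_norm_def abs_mult power2_abs by linarith
  qed
qed (use assms in \<open>auto simp: L2_def\<close>)

lemma AE_bounded_L2:
  fixes f :: "space3 \<Rightarrow> real"
  assumes f: "f \<in> borel_measurable M" and bound: "AE x in M. \<bar>f x\<bar> \<le> B"
  shows "f \<in> L2 \<Omega>"
proof -
  have "AE x in M. norm ((f x)\<^sup>2) \<le> B\<^sup>2"
    using bound by eventually_elim (metis abs_ge_zero abs_power2 power2_abs power_mono real_norm_def)
  then have "integrable M (\<lambda>x. (f x)\<^sup>2)"
    using f by (intro finite_measure.integrable_const_bound[OF finite_measure_domain, where B = "B\<^sup>2"]) auto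
  then show ?thesis
    using f by (auto simp: L2_def)
qed

lemma L2_integrable:
  assumes "f \<in> L2 \<Omega>"
  shows "integrable M f"
  using L2_mult_integrable[OF assms AE_bounded_L2[of "\<lambda>_. 1" 1]] by simp

text \<open>Linearity is stated throughout for \<open>u + c * v\<close>: one statement covers sums,
  differences (\<open>c = -1\<close>) and multiples (\<open>u = 0\<close>), and it matches the
  hypotheses of the Riesz argument below.\<close>

lemma L2_add_scale:
  assumes "f \<in> L2 \<Omega>" "g \<in> L2 \<Omega>"
  shows "(\<lambda>x. f x + c * g x) \<in> L2 \<Omega>"
proof -
  have "(\<lambda>x. (f x + c * g x)\<^sup>2) = (\<lambda>x. (f x)\<^sup>2 + 2 * c * (f x * g x) + c\<^sup>2 * (g x)\<^sup>2)"
    by (auto simp: power2_eq_square algebra_simps)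
  moreover have "integrable M (\<lambda>x. (f x)\<^sup>2 + 2 * c * (f x * g x) + c\<^sup>2 * (g x)\<^sup>2)"
    using assms L2_mult_integrable[OF assms] by (auto simp: L2_def)
  ultimately show ?thesis
    using assms by (auto simp: L2_def)
qed

lemma L2_mult_bounded:
  fixes g :: "space3 \<Rightarrow> real"
  assumes "f \<in> L2 \<Omega>" "g \<in> borel_measurable M" "\<And>x. \<bar>g x\<bar> \<le> B"
  shows "(\<lambda>x. f x * g x) \<in> L2 \<Omega>"
proof -
  have "integrable M (\<lambda>x. (f x * g x)\<^sup>2)"
  proof (rule Bochner_Integration.integrable_bound)
    show "integrable M (\<lambda>x. B\<^sup>2 * (f x)\<^sup>2)"
      using assms by (auto simp: L2_def)
    show "AE x in M. norm ((f x * g x)\<^sup>2) \<le> norm (B\<^sup>2 * (f x)\<^sup>2)"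
    proof (rule AE_I2)
      fix x
      have "(g x)\<^sup>2 \<le> B\<^sup>2"
        using assms(3)[of x] by (metis abs_ge_zero power2_abs power_mono)
      then show "norm ((f x * g x)\<^sup>2) \<le> norm (B\<^sup>2 * (f x)\<^sup>2)"
        by (simp add: power_mult_distrib mult.commute[of "B\<^sup>2"] mult_left_mono)
    qed
  qed (use assms in \<open>auto simp: L2_def\<close>)
  then show ?thesis
    using assms by (auto simp: L2_def)
qed

lemma l2_inner_add_scale_left:
  assumes "u \<in> L2 \<Omega>" "v \<in> L2 \<Omega>" "w \<in> L2 \<Omega>"
  shows "l2_inner \<Omega> (\<lambda>x. u x + c * v x) w = l2_inner \<Omega> u w + c * l2_inner \<Omega> v w"
proof -
  have "(\<lambda>x. (u x + c * v x) * w x) = (\<lambda>x. u x * w x + c * (v x * w x))"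
    by (auto simp: algebra_simps)
  then show ?thesis
    using L2_mult_integrable[OF assms(1,3)] L2_mult_integrable[OF assms(2,3)]
    by (simp add: l2_inner_def)
qed

lemma l2_inner_commute: "l2_inner \<Omega> u v = l2_inner \<Omega> v u"
  by (simp add: l2_inner_def mult.commute)

lemma l2_inner_add_scale_right:
  assumes "u \<in> L2 \<Omega>" "v \<in> L2 \<Omega>" "w \<in> L2 \<Omega>"
  shows "l2_inner \<Omega> u (\<lambda>x. v x + c * w x) = l2_inner \<Omega> u v + c * l2_inner \<Omega> u w"
  using l2_inner_add_scale_left[OF assms(2,3,1)] by (simp add: l2_inner_commute[of u])

lemma l2_norm_power2: "(l2_norm \<Omega> u)\<^sup>2 = l2_inner \<Omega> u u"
  by (simp add: l2_norm_def l2_inner_def power2_eq_square[symmetric])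

end

section \<open>Continuity, support and boundedness of test functions\<close>

lemma test_fun_continuous:
  assumes "\<psi> \<in> test_fun \<Omega>"
  shows "\<psi> differentiable at x" "continuous_on UNIV \<psi>" "continuous_on UNIV (partial i \<psi>)"
proof -
  have "iter_partial is \<psi> differentiable at y" for "is" y
    using assms by (auto simp: test_fun_def smooth_def)
  from this[of "[]"] this[of "[i]"]
  have *: "\<And>y. \<psi> differentiable at y" "\<And>y. partial i \<psi> differentiable at y" by simp_all
  then show "\<psi> differentiable at x" "continuous_on UNIV \<psi>" "continuous_on UNIV (partial i \<psi>)"
    by (auto intro!: continuous_at_imp_continuous_on differentiable_imp_continuous_within)
qed

lemma test_fun_vanishes:
  assumes "\<psi> \<in> test_fun \<Omega>" and x: "x \<notin> closure {x. \<psi> x \<noteq> 0}"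
  shows "\<psi> x = 0" "partial i \<psi> x = 0"
proof -
  let ?C = "closure {x. \<psi> x \<noteq> 0}"
  have zero: "\<psi> y = 0" if "y \<notin> ?C" for y
    using that closure_subset[of "{x. \<psi> x \<noteq> 0}"] by auto
  from zero x show "\<psi> x = 0" by blast
  have "(\<psi> has_derivative (\<lambda>_. 0)) (at x)"
  proof (rule has_derivative_transform_within_open[OF has_derivative_const])
    show "open (- ?C)"
      by (rule open_Compl[OF closed_closure])
    show "x \<in> - ?C"
      using x unfolding Compl_iff .
    show "0 = \<psi> y" if "y \<in> - ?C" for y
      using zero[OF ComplD[OF that]] by (rule sym)
  qed
  then show "partial i \<psi> x = 0"
    by (rule partial_eqI)
qed

lemma continuous_vanishing_bounded:
  fixes f :: "'a::topological_space \<Rightarrow> real"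
  assumes "continuous_on UNIV f" "compact C" "\<And>x. x \<notin> C \<Longrightarrow> f x = 0"
  obtains B where "\<And>x. \<bar>f x\<bar> \<le> B"
proof -
  have "bounded (f ` C)"
    by (intro compact_imp_bounded compact_continuous_image continuous_on_subset[OF assms(1)] assms(2)) simp
  then obtain B where "\<forall>y\<in>f ` C. norm y \<le> B" "B > 0"
    unfolding bounded_pos by blast
  then have "\<bar>f x\<bar> \<le> B" for x
    using assms(3)[of x] by (cases "x \<in> C") auto
  with that show ?thesis by blast
qed

lemma test_fun_bounded:
  assumes "\<psi> \<in> test_fun \<Omega>"
  obtains B where "\<And>x. \<bar>\<psi> x\<bar> \<le> B" "\<And>x. \<bar>partial i \<psi> x\<bar> \<le> B"
proof -
  have C: "compact (closure {x. \<psi> x \<noteq> 0})"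
    using assms by (auto simp: test_fun_def)
  obtain B1 where "\<And>x. \<bar>\<psi> x\<bar> \<le> B1"
    using continuous_vanishing_bounded[OF test_fun_continuous(2)[OF assms] C test_fun_vanishes(1)[OF assms]] by blast
  moreover obtain B2 where "\<And>x. \<bar>partial i \<psi> x\<bar> \<le> B2"
    using continuous_vanishing_bounded[OF test_fun_continuous(3)[OF assms] C test_fun_vanishes(2)[OF assms]] by blast
  ultimately show ?thesis
    using that[of "max B1 B2"] by (meson max.coboundedI1 max.coboundedI2)
qed

section \<open>Linearity and uniqueness of weak gradients, and the gradient form\<close>

context bounded_domain
begin

lemma test_fun_L2:
  assumes "\<psi> \<in> test_fun \<Omega>"
  shows "\<psi> \<in> L2 \<Omega>" "partial i \<psi> \<in> L2 \<Omega>"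
proof -
  obtain B where "\<And>x. \<bar>\<psi> x\<bar> \<le> B" "\<And>x. \<bar>partial i \<psi> x\<bar> \<le> B"
    using test_fun_bounded[OF assms] by blast
  then show "\<psi> \<in> L2 \<Omega>" "partial i \<psi> \<in> L2 \<Omega>"
    using test_fun_continuous(2,3)[OF assms]
    by (auto intro!: AE_bounded_L2 continuous_on_measurable_domain)
qed

lemma is_weak_grad_add_scale:
  assumes u: "u \<in> L2 \<Omega>" "is_weak_grad \<Omega> u g" and v: "v \<in> L2 \<Omega>" "is_weak_grad \<Omega> v k"
  shows "is_weak_grad \<Omega> (\<lambda>x. u x + c * v x) (\<lambda>x. g x + c *\<^sub>R k x)"
  unfolding is_weak_grad_def
proof (intro conjI allI ballI)
  fix i
  show "(\<lambda>x. (g x + c *\<^sub>R k x) $ i) \<in> L2 \<Omega>"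
    using u v L2_add_scale[of "\<lambda>x. g x $ i" "\<lambda>x. k x $ i" c] by (simp add: is_weak_grad_def)
next
  fix \<psi> i
  assume \<psi>: "\<psi> \<in> test_fun \<Omega>"
  have gk: "(\<lambda>x. g x $ i) \<in> L2 \<Omega>" "(\<lambda>x. k x $ i) \<in> L2 \<Omega>"
    using u v by (auto simp: is_weak_grad_def)
  have "l2_inner \<Omega> u (partial i \<psi>) = - l2_inner \<Omega> (\<lambda>x. g x $ i) \<psi>"
       "l2_inner \<Omega> v (partial i \<psi>) = - l2_inner \<Omega> (\<lambda>x. k x $ i) \<psi>"
    using u(2) v(2) \<psi> by (auto simp: is_weak_grad_def l2_inner_def)
  then have "l2_inner \<Omega> (\<lambda>x. u x + c * v x) (partial i \<psi>) =
      - l2_inner \<Omega> (\<lambda>x. g x $ i + c * k x $ i) \<psi>"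
    by (simp add: l2_inner_add_scale_left u v gk test_fun_L2[OF \<psi>])
  then show "(LINT x|M. (u x + c * v x) * partial i \<psi> x) = - (LINT x|M. (g x + c *\<^sub>R k x) $ i * \<psi> x)"
    by (simp add: l2_inner_def)
qed

text \<open>Both candidates satisfy the same integration by parts identity, so each component of
  their difference annihilates all test functions.\<close>

lemma is_weak_grad_unique:
  assumes "is_weak_grad \<Omega> u g" "is_weak_grad \<Omega> u k"
  shows "AE x in M. g x = k x"
proof -
  have "AE x in M. g x $ i - k x $ i = 0" for i
  proof (rule fundamental_lemma_calculus_of_variations[OF open_domain])
    have gk: "(\<lambda>x. g x $ i) \<in> L2 \<Omega>" "(\<lambda>x. k x $ i) \<in> L2 \<Omega>"
      using assms by (auto simp: is_weak_grad_def)
    then show "integrable M (\<lambda>x. g x $ i - k x $ i)"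
      by (intro Bochner_Integration.integrable_diff L2_integrable)
    fix \<psi>
    assume \<psi>: "\<psi> \<in> test_fun \<Omega>"
    have "- (LINT x|M. g x $ i * \<psi> x) = - (LINT x|M. k x $ i * \<psi> x)"
      using assms[unfolded is_weak_grad_def, THEN conjunct2, rule_format, OF \<psi>, of i] by simp
    then show "(LINT x|M. (g x $ i - k x $ i) * \<psi> x) = 0"
      using L2_mult_integrable[OF gk(1) test_fun_L2(1)[OF \<psi>]] L2_mult_integrable[OF gk(2) test_fun_L2(1)[OF \<psi>]]
      by (simp add: left_diff_distrib)
  qed
  then have "AE x in M. \<forall>i. g x $ i - k x $ i = 0"
    by (simp add: AE_all_countable)
  then show ?thesis
    by eventually_elim (simp add: vec_eq_iff)
qed

lemma is_weak_grad_wgrad: "is_weak_grad \<Omega> u g \<Longrightarrow> is_weak_grad \<Omega> u (wgrad \<Omega> u)"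
  unfolding wgrad_def by (rule someI[of "is_weak_grad \<Omega> u"])

lemma wgrad_is_weak_grad: "u \<in> H1 \<Omega> \<Longrightarrow> is_weak_grad \<Omega> u (wgrad \<Omega> u)"
  by (auto simp: H1_def is_weak_grad_wgrad)

lemma H1_L2: "u \<in> H1 \<Omega> \<Longrightarrow> u \<in> L2 \<Omega>"
  by (simp add: H1_def)

lemma weak_grad_inner_integrable:
  assumes "is_weak_grad \<Omega> u g" "is_weak_grad \<Omega> v k"
  shows "integrable M (\<lambda>x. g x \<bullet> k x)"
  using assms unfolding inner_vec_def inner_real_def
  by (intro Bochner_Integration.integrable_sum L2_mult_integrable) (auto simp: is_weak_grad_def)

lemma weak_grad_measurable:
  assumes "is_weak_grad \<Omega> u g"
  shows "g \<in> borel_measurable M"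
proof -
  have "(\<lambda>x. g x \<bullet> b) \<in> borel_measurable M" if "b \<in> Basis" for b
    using assms that L2_measurable
    by (auto simp: Basis_vec_def inner_axis is_weak_grad_def)
  then show ?thesis
    by (simp add: borel_measurable_euclidean_space[of g])
qed

text \<open>\<open>wgrad\<close> is an arbitrary choice, and the chosen gradient of a sum need not
  be the sum of the chosen ones. By almost everywhere uniqueness any convenient weak gradient may be
  used under the integral; bilinearity and the finite element computations rest on this.\<close>

lemma grad_inner_eq:
  assumes "is_weak_grad \<Omega> u g" "is_weak_grad \<Omega> v k"
  shows "grad_inner \<Omega> u v = (LINT x|M. g x \<bullet> k x)"
proof -
  have wg: "is_weak_grad \<Omega> u (wgrad \<Omega> u)" "is_weak_grad \<Omega> v (wgrad \<Omega> v)"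
    using assms by (auto intro: is_weak_grad_wgrad)
  note meas = assms[THEN weak_grad_measurable] wg[THEN weak_grad_measurable]
  have "AE x in M. wgrad \<Omega> u x \<bullet> wgrad \<Omega> v x = g x \<bullet> k x"
    using is_weak_grad_unique[OF wg(1) assms(1)] is_weak_grad_unique[OF wg(2) assms(2)]
    by eventually_elim simp
  then show ?thesis
    unfolding grad_inner_def using meas
    by (intro integral_cong_AE) auto
qed

lemma grad_inner_commute: "grad_inner \<Omega> u v = grad_inner \<Omega> v u"
  by (simp add: grad_inner_def inner_commute)

lemma grad_inner_nonneg: "0 \<le> grad_inner \<Omega> u u"
  by (simp add: grad_inner_def)

lemma grad_inner_add_scale_left:
  assumes "u \<in> H1 \<Omega>" "v \<in> H1 \<Omega>" "w \<in> H1 \<Omega>"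
  shows "grad_inner \<Omega> (\<lambda>x. u x + c * v x) w = grad_inner \<Omega> u w + c * grad_inner \<Omega> v w"
proof -
  note wg = assms[THEN wgrad_is_weak_grad]
  have "grad_inner \<Omega> (\<lambda>x. u x + c * v x) w =
      (LINT x|M. wgrad \<Omega> u x \<bullet> wgrad \<Omega> w x + c * (wgrad \<Omega> v x \<bullet> wgrad \<Omega> w x))"
    using grad_inner_eq[OF is_weak_grad_add_scale[OF _ wg(1) _ wg(2)] wg(3)] assms
    by (simp add: H1_L2 inner_add_left)
  then show ?thesis
    using weak_grad_inner_integrable[OF wg(1,3)] weak_grad_inner_integrable[OF wg(2,3)]
    by (simp add: grad_inner_def)
qed

lemma grad_inner_add_scale_right:
  assumes "u \<in> H1 \<Omega>" "v \<in> H1 \<Omega>" "w \<in> H1 \<Omega>"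
  shows "grad_inner \<Omega> u (\<lambda>x. v x + c * w x) = grad_inner \<Omega> u v + c * grad_inner \<Omega> u w"
  using grad_inner_add_scale_left[OF assms(2,3,1)] by (simp add: grad_inner_commute[of u])

end

section \<open>Riesz representation\<close>

text \<open>Finite dimensionality enters as determination of the elements of \<open>S\<close> by their values on a finite
  set \<open>P\<close>. Removing one point from \<open>P\<close> passes to a subspace of codimension at most one, and the
  induction on \<open>P\<close> is a Gram-Schmidt step.\<close>

lemma riesz_representation_on_function_space:
  fixes S :: "('a \<Rightarrow> real) set" and B :: "('a \<Rightarrow> real) \<Rightarrow> ('a \<Rightarrow> real) \<Rightarrow> real"
  assumes "finite P"
    and zero: "(\<lambda>_. 0) \<in> S"
    and lin: "\<And>u v c. u \<in> S \<Longrightarrow> v \<in> S \<Longrightarrow> (\<lambda>x. u x + c * v x) \<in> S"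
    and det: "\<And>u. u \<in> S \<Longrightarrow> (\<And>p. p \<in> P \<Longrightarrow> u p = 0) \<Longrightarrow> u = (\<lambda>_. 0)"
    and sym: "\<And>u v. u \<in> S \<Longrightarrow> v \<in> S \<Longrightarrow> B u v = B v u"
    and B_lin: "\<And>u v w c. u \<in> S \<Longrightarrow> v \<in> S \<Longrightarrow> w \<in> S \<Longrightarrow> B (\<lambda>x. u x + c * v x) w = B u w + c * B v w"
    and pos: "\<And>u. u \<in> S \<Longrightarrow> u \<noteq> (\<lambda>_. 0) \<Longrightarrow> B u u > 0"
    and F_lin: "\<And>u v c. u \<in> S \<Longrightarrow> v \<in> S \<Longrightarrow> F (\<lambda>x. u x + c * v x) = F u + c * F v"
  shows "\<exists>!w. w \<in> S \<and> (\<forall>v\<in>S. B w v = F v)"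
proof -
  have ex: "\<exists>w\<in>S. \<forall>v\<in>S. B w v = F v"
    using \<open>finite P\<close> zero lin det sym B_lin pos F_lin
  proof (induction P arbitrary: S F)
    case empty
    have "u = (\<lambda>_. 0)" if "u \<in> S" for u
      using empty.prems(3)[OF that] by simp
    \<comment> \<open>With \<open>c = 1\<close>, linearity gives a value at zero that equals twice
      itself.\<close>
    moreover have "B (\<lambda>_. 0) (\<lambda>_. 0) = 0" "F (\<lambda>_. 0) = 0"
      using empty.prems(5)[of "\<lambda>_. 0" "\<lambda>_. 0" "\<lambda>_. 0" 1] empty.prems(7)[of "\<lambda>_. 0" "\<lambda>_. 0" 1] empty.prems(1)
      by simp_all
    ultimately show ?case
      using empty.prems(1) by (metis (no_types))
  next
    case (insert p P)
    note zero = insert.prems(1) and lin = insert.prems(2) and det = insert.prems(3)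
      and sym = insert.prems(4) and B_lin = insert.prems(5) and pos = insert.prems(6)
    define S' where "S' = {v \<in> S. v p = 0}"
    have S'_S: "u \<in> S" if "u \<in> S'" for u
      using that by (simp add: S'_def)
    have IH: "\<exists>w\<in>S'. \<forall>v\<in>S'. B w v = G v"
      if G: "\<And>u v c. u \<in> S \<Longrightarrow> v \<in> S \<Longrightarrow> G (\<lambda>x. u x + c * v x) = G u + c * G v" for G
    proof (rule insert.IH)
      show "(\<lambda>_. 0) \<in> S'" using zero by (simp add: S'_def)
      show "(\<lambda>x. u x + c * v x) \<in> S'" if "u \<in> S'" "v \<in> S'" for u v c
        using lin that by (simp add: S'_def)
      show "u = (\<lambda>_. 0)" if "u \<in> S'" "\<And>p. p \<in> P \<Longrightarrow> u p = 0" for u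
        using that by (intro det) (auto simp: S'_def)
      show "B u v = B v u" if "u \<in> S'" "v \<in> S'" for u v
        using that by (intro sym S'_S)
      show "B (\<lambda>x. u x + c * v x) w = B u w + c * B v w" if "u \<in> S'" "v \<in> S'" "w \<in> S'" for u v w c
        using that by (intro B_lin S'_S)
      show "B u u > 0" if "u \<in> S'" "u \<noteq> (\<lambda>_. 0)" for u
        using that by (intro pos S'_S)
      show "G (\<lambda>x. u x + c * v x) = G u + c * G v" if "u \<in> S'" "v \<in> S'" for u v c
        using that by (intro G S'_S)
    qed
    obtain w' where w': "w' \<in> S'" "\<And>v. v \<in> S' \<Longrightarrow> B w' v = F v"
      using IH[of F] insert.prems(7) by blast
    show ?case
    proof (cases "S = S'")
      case True
      with w' show ?thesis by blast
    next
      case False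
      then obtain u where u: "u \<in> S" "u p \<noteq> 0"
        by (auto simp: S'_def)
      have "B u (\<lambda>x. v x + c * w x) = B u v + c * B u w" if "v \<in> S" "w \<in> S" for v w c
        using that u(1) lin[of v w c] by (simp add: sym[OF u(1)] B_lin)
      from IH[of "B u", OF this] obtain u' where u': "u' \<in> S'" "\<And>v. v \<in> S' \<Longrightarrow> B u' v = B u v"
        by blast
      \<comment> \<open>The induction hypothesis for the functional \<open>B u\<close> has produced
        the orthogonal projection \<open>u'\<close> of \<open>u\<close> onto \<open>S'\<close>.
        Hence \<open>z\<close> is orthogonal to \<open>S'\<close>, and it does not vanish at
        \<open>p\<close> because \<open>u'\<close> does.\<close>
      define z where "z = (\<lambda>x. u x + (-1) * u' x)"
      have z: "z \<in> S" "z p \<noteq> 0"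
        using u u' lin[of u u' "-1"] by (auto simp: z_def S'_def)
      have orth: "B z v = 0" if "v \<in> S'" for v
        using B_lin[OF u(1) S'_S[OF u'(1)] S'_S[OF that], of "-1"] u'(2)[OF that] by (simp add: z_def)
      have Bz: "B z z > 0"
        using pos[OF z(1)] z(2) by auto
      \<comment> \<open>The representer on \<open>S'\<close> is corrected along \<open>z\<close>.
        Orthogonality leaves the values on \<open>S'\<close> unchanged, and the coefficient makes
        the value at \<open>z\<close> equal to \<open>F z\<close>.\<close>
      define w where "w = (\<lambda>x. w' x + F z / B z z * z x)"
      have w: "w \<in> S"
        unfolding w_def by (rule lin[OF S'_S[OF w'(1)] z(1)])
      have Bw: "B w v = B w' v + F z / B z z * B z v" if "v \<in> S" for v
        unfolding w_def by (rule B_lin[OF S'_S[OF w'(1)] z(1) that])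
      have "B w v = F v" if v: "v \<in> S" for v
      proof -
        \<comment> \<open>This \<open>c\<close> makes \<open>v'\<close> vanish at \<open>p\<close>,
          so every \<open>v\<close> splits into an element of \<open>S'\<close> and a multiple of
          \<open>z\<close>.\<close>
        define c where "c = v p / z p"
        define v' where "v' = (\<lambda>x. v x + (- c) * z x)"
        have "v' \<in> S"
          unfolding v'_def by (rule lin[OF v z(1)])
        then have v': "v' \<in> S'"
          using z(2) by (simp add: v'_def S'_def c_def)
        have v_eq: "(\<lambda>x. v' x + c * z x) = v"
          by (simp add: v'_def)
        have 1: "B v' w = F v'"
          using Bw[OF S'_S[OF v']] orth[OF v'] w'(2)[OF v'] sym[OF w S'_S[OF v']] by simp
        have 2: "B z w = F z"
          using Bw[OF z(1)] orth[OF w'(1)] Bz sym[OF w z(1)] sym[OF S'_S[OF w'(1)] z(1)] by simp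
        have "B v w = B v' w + c * B z w" "F v = F v' + c * F z"
          using B_lin[OF S'_S[OF v'] z(1) w, of c] insert.prems(7)[OF S'_S[OF v'] z(1), of c]
          unfolding v_eq by simp_all
        with 1 2 show ?thesis
          using sym[OF w v] by simp
      qed
      with w show ?thesis by blast
    qed
  qed
  have unique: "w1 = w2"
    if w: "w1 \<in> S" "\<forall>v\<in>S. B w1 v = F v" "w2 \<in> S" "\<forall>v\<in>S. B w2 v = F v" for w1 w2
  proof (rule ccontr)
    assume ne: "w1 \<noteq> w2"
    define d where "d = (\<lambda>x. w1 x + (-1) * w2 x)"
    have d: "d \<in> S"
      unfolding d_def by (rule lin[OF w(1,3)])
    have "d \<noteq> (\<lambda>_. 0)"
      using ne by (auto simp: d_def fun_eq_iff)
    moreover have "B d d = 0"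
      using B_lin[OF w(1,3) d, of "-1"] w d unfolding d_def[symmetric] by simp
    ultimately show False
      using pos[OF d] by simp
  qed
  from ex obtain w where "w \<in> S" "\<forall>v\<in>S. B w v = F v" by blast
  then show ?thesis
    using unique by (intro ex1I[of _ w]) auto
qed

section \<open>Difference quotients\<close>

lemma lborel_integral_translation:
  fixes f :: "'a::euclidean_space \<Rightarrow> real"
  assumes "f \<in> borel_measurable borel"
  shows "(LINT x|lborel. f (c + x)) = (LINT x|lborel. f x)"
  using integral_distr[of "(+) c" lborel borel f] assms by (simp add: lborel_distr_plus)

lemma continuous_vanishing_integrable:
  fixes f :: "'a::euclidean_space \<Rightarrow> real"
  assumes "continuous_on UNIV f" "compact C" "\<And>x. x \<notin> C \<Longrightarrow> f x = 0"
  shows "integrable lborel f"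
proof -
  have "integrable lborel (\<lambda>x. indicator C x *\<^sub>R f x)"
    using assms by (intro borel_integrable_compact continuous_on_subset[OF assms(1)]) auto
  moreover have "(\<lambda>x. indicator C x *\<^sub>R f x) = f"
    using assms(3) by (auto simp: fun_eq_iff indicator_def)
  ultimately show ?thesis by simp
qed

lemma directional_has_real_derivative:
  fixes f :: "'a::real_normed_vector \<Rightarrow> real"
  assumes "(f has_derivative f') (at (x + s *\<^sub>R e))"
  shows "((\<lambda>t. f (x + t *\<^sub>R e)) has_real_derivative f' e) (at s)"
proof -
  have "((\<lambda>t. f (x + t *\<^sub>R e)) has_derivative (\<lambda>t. f' (t *\<^sub>R e))) (at s)"
    by (rule has_derivative_compose[of "\<lambda>t. x + t *\<^sub>R e" _ s UNIV f, OF _ assms])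
       (auto intro!: derivative_eq_intros)
  moreover have "(\<lambda>t. f' (t *\<^sub>R e)) = (*) (f' e)"
    using assms by (auto simp: has_derivative_def bounded_linear.linear linear_cmul)
  ultimately show ?thesis
    by (simp add: has_field_derivative_def)
qed

text \<open>Step sizes run through a sequence, so that dominated convergence and measurability of
  pointwise limits apply directly.\<close>

definition diff_quot :: "('a::real_normed_vector \<Rightarrow> real) \<Rightarrow> 'a \<Rightarrow> nat \<Rightarrow> 'a \<Rightarrow> real" where
  "diff_quot f e n x = (f (x + (1 / real (Suc n)) *\<^sub>R e) - f x) * real (Suc n)"

lemma diff_quot_tendsto:
  fixes f :: "'a::real_normed_vector \<Rightarrow> real"
  assumes "(f has_derivative f') (at x)"
  shows "(\<lambda>n. diff_quot f e n x) \<longlonglongrightarrow> f' e"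
proof -
  have "((\<lambda>t. f (x + t *\<^sub>R e)) has_real_derivative f' e) (at 0)"
    using assms by (intro directional_has_real_derivative) simp
  then have lim: "((\<lambda>h. (f (x + h *\<^sub>R e) - f x) / h) \<longlongrightarrow> f' e) (at 0)"
    by (simp add: DERIV_def)
  have "filterlim (\<lambda>n. 1 / real (Suc n)) (at 0) sequentially"
    using LIMSEQ_inverse_real_of_nat by (auto simp: filterlim_at inverse_eq_divide)
  from filterlim_compose[OF lim this] show ?thesis
    by (simp add: diff_quot_def)
qed

lemma diff_quot_bound:
  fixes f :: "'a::real_normed_vector \<Rightarrow> real"
  assumes "\<And>x y. \<bar>f x - f y\<bar> \<le> L * norm (x - y)"
  shows "\<bar>diff_quot f e n x\<bar> \<le> L * norm e"
proof -
  have "\<bar>diff_quot f e n x\<bar> = \<bar>f (x + (1 / real (Suc n)) *\<^sub>R e) - f x\<bar> * real (Suc n)"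
    unfolding diff_quot_def abs_mult by simp
  also have "\<dots> \<le> (L * norm ((1 / real (Suc n)) *\<^sub>R e)) * real (Suc n)"
    using assms[of "x + (1 / real (Suc n)) *\<^sub>R e" x] by (intro mult_right_mono) simp_all
  also have "\<dots> = L * norm e"
    by simp
  finally show ?thesis .
qed

text \<open>Discrete integration by parts: translation invariance moves the shift from
  \<open>f\<close> to \<open>g\<close> and reverses its direction. The usual minus sign is absorbed
  by the direction \<open>- e\<close>. Compact supports make the separate products
  integrable.\<close>

lemma integral_diff_quot:
  fixes f g :: "'a::euclidean_space \<Rightarrow> real"
  assumes f: "continuous_on UNIV f" and g: "continuous_on UNIV g"
    and C: "compact C" "\<And>x. x \<notin> C \<Longrightarrow> f x = 0" and D: "compact D" "\<And>x. x \<notin> D \<Longrightarrow> g x = 0"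
  shows "(LINT x|lborel. diff_quot f e n x * g x) = (LINT x|lborel. f x * diff_quot g (- e) n x)"
proof -
  define d where "d = (1 / real (Suc n)) *\<^sub>R e"
  have cont: "continuous_on UNIV (\<lambda>x. f (x + d))" "continuous_on UNIV (\<lambda>x. g (x - d))"
    by (auto intro!: continuous_on_compose2[OF f] continuous_on_compose2[OF g] continuous_intros)
  have int: "integrable lborel (\<lambda>x. f (x + d) * g x)" "integrable lborel (\<lambda>x. f x * g x)"
    by (rule continuous_vanishing_integrable[OF _ D(1)], intro continuous_on_mult cont f g, simp add: D(2))+
  have int': "integrable lborel (\<lambda>x. f x * g (x - d))"
    by (rule continuous_vanishing_integrable[OF _ C(1)], intro continuous_on_mult cont f g, simp add: C(2))
  have "(\<lambda>x. f x * g (x - d)) \<in> borel_measurable borel"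
    by (intro borel_measurable_continuous_onI continuous_on_mult f cont)
  from lborel_integral_translation[OF this, of d]
  have shift: "(LINT x|lborel. f (x + d) * g x) = (LINT x|lborel. f x * g (x - d))"
    by (simp add: add.commute)
  have "(LINT x|lborel. diff_quot f e n x * g x) =
      (LINT x|lborel. real (Suc n) * (f (x + d) * g x - f x * g x))"
    by (intro Bochner_Integration.integral_cong) (auto simp: diff_quot_def d_def algebra_simps)
  also have "\<dots> = (LINT x|lborel. real (Suc n) * (f x * g (x - d) - f x * g x))"
    using int int' shift by simp
  also have "\<dots> = (LINT x|lborel. f x * diff_quot g (- e) n x)"
    by (intro Bochner_Integration.integral_cong) (auto simp: diff_quot_def d_def algebra_simps)
  finally show ?thesis .
qed

text \<open>The two claims are pointwise convergence and the uniform bound needed for dominated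
  convergence.\<close>

lemma test_fun_diff_quot:
  assumes \<psi>: "\<psi> \<in> test_fun \<Omega>"
  shows "(\<lambda>n. diff_quot \<psi> (- axis i 1) n x) \<longlonglongrightarrow> - partial i \<psi> x"
    and "(\<And>y. \<bar>partial i \<psi> y\<bar> \<le> B) \<Longrightarrow> \<bar>diff_quot \<psi> (- axis i 1) n x\<bar> \<le> B"
proof -
  have D: "(\<psi> has_derivative frechet_derivative \<psi> (at y)) (at y)" for y
    using test_fun_continuous(1)[OF \<psi>] by (simp add: frechet_derivative_works)
  have neg: "frechet_derivative \<psi> (at y) (- axis i 1) = - partial i \<psi> y" for y
    using D[of y] by (simp add: partial_def has_derivative_def bounded_linear.linear linear_neg)
  show "(\<lambda>n. diff_quot \<psi> (- axis i 1) n x) \<longlonglongrightarrow> - partial i \<psi> x"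
    using diff_quot_tendsto[OF D, where e = "- axis i 1"] by (simp add: neg)
  assume B: "\<And>y. \<bar>partial i \<psi> y\<bar> \<le> B"
  let ?e = "- axis i 1 :: space3"
  \<comment> \<open>The mean value theorem on the segment from \<open>x\<close> to the shifted point
    turns the quotient into a directional derivative at an intermediate point.\<close>
  have "\<exists>z. 0 < z \<and> z < 1 / real (Suc n) \<and>
      \<psi> (x + (1 / real (Suc n)) *\<^sub>R ?e) - \<psi> (x + 0 *\<^sub>R ?e) =
        (1 / real (Suc n) - 0) * frechet_derivative \<psi> (at (x + z *\<^sub>R ?e)) ?e"
    by (rule MVT2) (simp, rule directional_has_real_derivative[OF D])
  then obtain z where "\<psi> (x + (1 / real (Suc n)) *\<^sub>R ?e) - \<psi> x =
      (1 / real (Suc n)) * (- partial i \<psi> (x + z *\<^sub>R ?e))"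
    by (auto simp: neg)
  then have "diff_quot \<psi> ?e n x = - partial i \<psi> (x + z *\<^sub>R ?e)"
    unfolding diff_quot_def by simp
  then show "\<bar>diff_quot \<psi> (- axis i 1) n x\<bar> \<le> B"
    using B by simp
qed

text \<open>Nonempty open sets are not null. Almost everywhere information about finite element
  functions becomes pointwise information through this.\<close>

lemma AE_lebesgue_open_witness:
  fixes U :: "'a::euclidean_space set"
  assumes "AE x in lebesgue. P x" "open U" "U \<noteq> {}"
  obtains x where "x \<in> U" "P x"
proof -
  obtain N where N: "N \<in> null_sets lebesgue" "{x \<in> space lebesgue. \<not> P x} \<subseteq> N"
    using assms(1) unfolding eventually_ae_filter by blast
  have "\<not> U \<subseteq> N"
    using N(1) open_not_negligible[OF assms(2,3)] negligible_subset
    by (auto simp: negligible_iff_null_sets[symmetric])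
  then show ?thesis
    using that N(2) by auto
qed

section \<open>The finite element space\<close>

locale fe_mesh = bounded_domain +
  fixes \<T> :: "space3 set set"
  assumes mesh: "triangulation_of \<Omega> \<T>"
begin

abbreviation "S \<equiv> fe_space \<T>"

lemma finite_mesh: "finite \<T>"
  using mesh by (auto simp: triangulation_of_def triangulation_def)

lemma mesh_vertices:
  assumes "K \<in> \<T>"
  obtains C where "finite C" "K = convex hull C"
proof -
  have "3 simplex K"
    using mesh assms by (auto simp: triangulation_of_def)
  then show ?thesis
    using that by (auto simp: simplex)
qed

lemma mesh_compact_convex:
  assumes "K \<in> \<T>"
  shows "compact K" "convex K"
proof -
  obtain C where "finite C" "K = convex hull C"
    by (rule mesh_vertices[OF assms])
  then show "compact K" "convex K"
    by (simp_all add: finite_imp_compact_convex_hull)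
qed

text \<open>The mesh is only known to lie in \<open>closure \<Omega>\<close>. A full-dimensional
  simplex has nonempty interior, and an open set that meets the closure of \<open>\<Omega>\<close>
  meets \<open>\<Omega>\<close>.\<close>

lemma mesh_interior_meets_domain:
  assumes "K \<in> \<T>"
  shows "open (interior K \<inter> \<Omega>)" "interior K \<inter> \<Omega> \<noteq> {}"
proof -
  show "open (interior K \<inter> \<Omega>)"
    using open_domain by auto
  have "3 simplex K"
    using mesh assms by (auto simp: triangulation_of_def)
  then have "aff_dim K = 3"
    by (rule aff_dim_simplex)
  then have "interior K \<noteq> {}"
    using mesh_compact_convex(2)[OF assms] rel_interior_eq_empty[of K]
    by (auto simp: interior_rel_interior_gen)
  moreover have "interior K \<subseteq> closure \<Omega>"
    using mesh assms interior_subset[of K] by (auto simp: triangulation_of_def)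
  ultimately show "interior K \<inter> \<Omega> \<noteq> {}"
    using open_Int_closure_eq_empty[of "interior K" \<Omega>] by auto
qed

lemma compact_mesh: "compact (\<Union>\<T>)"
  using finite_mesh mesh_compact_convex by (intro compact_Union) auto

lemma fe_zero: "(\<lambda>_. 0) \<in> S"
proof -
  have "\<exists>a b. \<forall>x\<in>K. (0::real) = a \<bullet> x + b" for K :: "space3 set"
    by (intro exI[of _ 0]) simp
  then show ?thesis
    by (simp add: fe_space_def)
qed

lemma fe_continuous: "v \<in> S \<Longrightarrow> continuous_on UNIV v"
  by (simp add: fe_space_def)

lemma fe_outside: "v \<in> S \<Longrightarrow> x \<notin> \<Union>\<T> \<Longrightarrow> v x = 0"
  by (simp add: fe_space_def)

lemma fe_affine:
  assumes "v \<in> S" "K \<in> \<T>"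
  obtains a b where "\<forall>x\<in>K. v x = a \<bullet> x + b"
proof -
  have "\<forall>K\<in>\<T>. \<exists>a b. \<forall>x\<in>K. v x = a \<bullet> x + b"
    using assms(1) unfolding fe_space_def mem_Collect_eq by (elim conjE)
  from bspec[OF this assms(2)] obtain a b where "\<forall>x\<in>K. v x = a \<bullet> x + b"
    by (elim exE)
  then show ?thesis
    by (rule that)
qed

lemma fe_add_scale:
  assumes "u \<in> S" "v \<in> S"
  shows "(\<lambda>x. u x + c * v x) \<in> S"
proof -
  have "\<exists>a b. \<forall>x\<in>K. u x + c * v x = a \<bullet> x + b" if K: "K \<in> \<T>" for K
  proof -
    obtain a b where ab: "\<forall>x\<in>K. u x = a \<bullet> x + b"
      by (rule fe_affine[OF assms(1) K])
    obtain a' b' where ab': "\<forall>x\<in>K. v x = a' \<bullet> x + b'"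
      by (rule fe_affine[OF assms(2) K])
    have "\<forall>x\<in>K. u x + c * v x = (a + c *\<^sub>R a') \<bullet> x + (b + c * b')"
      by (simp add: ab ab' inner_add_left algebra_simps)
    then show ?thesis by (intro exI)
  qed
  moreover have "continuous_on UNIV (\<lambda>x. u x + c * v x)" "\<forall>x. x \<notin> \<Union>\<T> \<longrightarrow> u x + c * v x = 0"
    using assms[THEN fe_continuous] fe_outside[OF assms(1)] fe_outside[OF assms(2)]
    by (auto intro!: continuous_intros)
  ultimately show ?thesis
    by (simp add: fe_space_def)
qed

lemma fe_scale:
  assumes "v \<in> S"
  shows "(\<lambda>x. c * v x) \<in> S"
  using fe_add_scale[OF fe_zero assms, of c] by simp

lemma fe_bounded:
  assumes "v \<in> S"
  obtains B where "\<And>x. \<bar>v x\<bar> \<le> B"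
  using continuous_vanishing_bounded[OF fe_continuous[OF assms] compact_mesh fe_outside[OF assms]]
  by blast

text \<open>Such a point is a limit of points outside the mesh, where \<open>v\<close> is zero;
  continuity does the rest.\<close>

lemma fe_vanishes_off_interior:
  assumes "v \<in> S" "x \<notin> interior (\<Union>\<T>)"
  shows "v x = 0"
proof -
  have "x \<in> closure (- \<Union>\<T>)"
    using assms(2) by (simp add: closure_complement)
  moreover have "closure (- \<Union>\<T>) \<subseteq> {x. v x = 0}"
    using fe_outside[OF assms(1)] closed_Collect_eq[of v "\<lambda>_. 0"] fe_continuous[OF assms(1)]
    by (intro closure_minimal) auto
  ultimately show ?thesis by blast
qed

text \<open>Restricted to a segment, \<open>v\<close> is Lipschitz on each of finitely many closed
  pieces: those inside a tetrahedron, where it is affine, and the one off the interior of the mesh,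
  where it is zero. Since these pieces cover the parameter interval, the bounds combine to one along
  the whole segment.\<close>

lemma fe_lipschitz:
  assumes v: "v \<in> S"
  obtains L where "\<And>x y. \<bar>v x - v y\<bar> \<le> L * norm (x - y)"
proof -
  have "\<exists>a. \<forall>K\<in>\<T>. \<exists>b. \<forall>x\<in>K. v x = a K \<bullet> x + b"
    using v by (intro bchoice) (auto simp: fe_space_def)
  then obtain a where a: "\<And>K. K \<in> \<T> \<Longrightarrow> \<exists>b. \<forall>x\<in>K. v x = a K \<bullet> x + b"
    by blast
  define L where "L = (\<Sum>K\<in>\<T>. norm (a K))"
  have L: "norm (a K) \<le> L" if "K \<in> \<T>" for K
    unfolding L_def using finite_mesh that by (intro member_le_sum) auto
  have L0: "0 \<le> L"
    by (simp add: L_def sum_nonneg)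
  have "\<bar>v x - v y\<bar> \<le> L * norm (x - y)" for x y
  proof -
    define p where "p t = x + t *\<^sub>R (y - x)" for t
    have p_cont: "continuous_on UNIV p"
      unfolding p_def by (intro continuous_intros)
    \<comment> \<open>The pieces are indexed by the sets themselves. The complement of the interior,
      rather than of the mesh, is taken as exterior piece because it is closed.\<close>
    define U where "U K = p -` (if K \<in> \<T> then K else - interior (\<Union>\<T>))" for K
    \<comment> \<open>The exterior index must not be mistaken for a tetrahedron in the case
      distinction of \<open>U\<close>; otherwise the whole space would be a bounded set.\<close>
    have off: "- interior (\<Union>\<T>) \<notin> \<T>"
    proof
      assume "- interior (\<Union>\<T>) \<in> \<T>"
      then have "bounded (- interior (\<Union>\<T>) \<union> \<Union>\<T>)"
        using mesh_compact_convex(1) compact_mesh by (blast intro: compact_imp_bounded bounded_Un[THEN iffD2])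
      moreover have "- interior (\<Union>\<T>) \<union> \<Union>\<T> = UNIV"
        using interior_subset by blast
      ultimately show False
        by (simp add: not_bounded_UNIV)
    qed
    have "(L * norm (y - x))-lipschitz_on {0..1} (\<lambda>t. v (p t))"
    proof (rule lipschitz_on_closed_Union[where I = "insert (- interior (\<Union>\<T>)) \<T>" and U = U])
      show "finite (insert (- interior (\<Union>\<T>)) \<T>)"
        using finite_mesh by simp
      show "0 \<le> L * norm (y - x)"
        using L0 by simp
      show "{0..1} \<subseteq> (\<Union>i\<in>insert (- interior (\<Union>\<T>)) \<T>. U i)"
        using interior_subset[of "\<Union>\<T>"] off by (auto simp: U_def)
      fix K assume K: "K \<in> insert (- interior (\<Union>\<T>)) \<T>"
      show "closed (U K)"
        unfolding U_def using mesh_compact_convex(1)[of K] p_cont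
        by (intro continuous_closed_vimage) (auto simp: compact_imp_closed continuous_on_eq_continuous_at)
      show "(L * norm (y - x))-lipschitz_on (U K) (\<lambda>t. v (p t))"
      proof (rule lipschitz_onI)
        fix s t assume st: "s \<in> U K" "t \<in> U K"
        show "dist (v (p s)) (v (p t)) \<le> L * norm (y - x) * dist s t"
        proof (cases "K \<in> \<T>")
          case True
          then obtain b where "\<And>x. x \<in> K \<Longrightarrow> v x = a K \<bullet> x + b"
            using a by blast
          with st True have "v (p s) - v (p t) = a K \<bullet> (p s - p t)"
            by (auto simp: U_def inner_diff_right)
          also have "\<bar>\<dots>\<bar> \<le> norm (a K) * norm (p s - p t)"
            by (rule Cauchy_Schwarz_ineq2)
          also have "\<dots> \<le> L * norm (p s - p t)"
            using L[OF True] by (rule mult_right_mono) simp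
          also have "p s - p t = (s - t) *\<^sub>R (y - x)"
            by (simp add: p_def algebra_simps)
          finally show ?thesis
            by (simp add: dist_real_def mult_ac)
        next
          case False
          with st have "v (p s) = 0" "v (p t) = 0"
            by (auto simp: U_def intro!: fe_vanishes_off_interior[OF v])
          then show ?thesis
            using L0 by simp
        qed
      qed (use L0 in simp)
    qed
    from lipschitz_onD[OF this, of 0 1] show ?thesis
      by (simp add: p_def dist_real_def norm_minus_commute)
  qed
  with that show ?thesis by blast
qed

text \<open>This supplies the finite point set for the Riesz argument: an affine function that
  vanishes at the vertices vanishes on their convex hull.\<close>

lemma fe_determined_by_vertices:
  obtains P where "finite P" "\<And>v. v \<in> S \<Longrightarrow> (\<And>p. p \<in> P \<Longrightarrow> v p = 0) \<Longrightarrow> v = (\<lambda>_. 0)"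
proof -
  have "\<exists>C. \<forall>K\<in>\<T>. finite (C K) \<and> K = convex hull C K"
    using mesh_vertices by (intro bchoice) metis
  then obtain C where C: "\<And>K. K \<in> \<T> \<Longrightarrow> finite (C K)" "\<And>K. K \<in> \<T> \<Longrightarrow> K = convex hull C K"
    by blast
  show ?thesis
  proof (rule that[of "\<Union>K\<in>\<T>. C K"])
    show "finite (\<Union>K\<in>\<T>. C K)"
      using finite_mesh C by blast
    fix v assume v: "v \<in> S" and zero: "\<And>p. p \<in> (\<Union>K\<in>\<T>. C K) \<Longrightarrow> v p = 0"
    have "v x = 0" if x: "x \<in> K" and K: "K \<in> \<T>" for x K
    proof -
      obtain a b where ab: "\<forall>x\<in>K. v x = a \<bullet> x + b"
        by (rule fe_affine[OF v K])
      have "C K \<subseteq> {x. a \<bullet> x = - b}"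
      proof
        fix p assume p: "p \<in> C K"
        then have "p \<in> K"
          by (subst C(2)[OF K]) (rule hull_inc)
        moreover have "v p = 0"
          using p K by (intro zero) blast
        ultimately show "p \<in> {x. a \<bullet> x = - b}"
          using bspec[OF ab, of p] by simp
      qed
      then have "convex hull C K \<subseteq> {x. a \<bullet> x = - b}"
        by (rule hull_minimal) (rule convex_hyperplane)
      then show ?thesis
        using bspec[OF ab x] x C(2)[OF K] by auto
    qed
    then show "v = (\<lambda>_. 0)"
      using fe_outside[OF v] by (intro ext) blast
  qed
qed

end

section \<open>The weak gradient of a finite element function\<close>

text \<open>The limit exists off the null set formed by the frontiers of the tetrahedra; elsewhere the value
  is junk.\<close>

definition fe_grad :: "(space3 \<Rightarrow> real) \<Rightarrow> space3 \<Rightarrow> space3" where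
  "fe_grad v x = (\<chi> i. lim (\<lambda>n. diff_quot v (axis i 1) n x))"

lemma fe_grad_eqI:
  assumes "(v has_derivative (\<lambda>h. a \<bullet> h)) (at x)"
  shows "fe_grad v x = a" "(\<lambda>n. diff_quot v (axis i 1) n x) \<longlonglongrightarrow> fe_grad v x $ i"
proof -
  have lim: "(\<lambda>n. diff_quot v (axis i 1) n x) \<longlonglongrightarrow> a $ i" for i
    using diff_quot_tendsto[OF assms, of "axis i 1"] by (simp add: inner_axis)
  then show "fe_grad v x = a"
    by (simp add: fe_grad_def vec_eq_iff limI)
  with lim show "(\<lambda>n. diff_quot v (axis i 1) n x) \<longlonglongrightarrow> fe_grad v x $ i"
    by simp
qed

context fe_mesh
begin

lemma fe_has_derivative_interior:
  assumes ab: "\<forall>x\<in>K. v x = a \<bullet> x + b" and x: "x \<in> interior K"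
  shows "(v has_derivative (\<lambda>h. a \<bullet> h)) (at x)"
proof (rule has_derivative_transform_within_open)
  show "((\<lambda>x. a \<bullet> x + b) has_derivative (\<lambda>h. a \<bullet> h)) (at x)"
    by (auto intro!: derivative_eq_intros)
  show "open (interior K)" "x \<in> interior K"
    using x by simp_all
  show "a \<bullet> y + b = v y" if "y \<in> interior K" for y
    using bspec[OF ab, of y] that interior_subset[of K] by auto
qed

lemma fe_has_derivative_outside:
  assumes v: "v \<in> S" and x: "x \<notin> \<Union>\<T>"
  shows "(v has_derivative (\<lambda>h. 0 \<bullet> h)) (at x)"
  unfolding inner_zero_left
proof (rule has_derivative_transform_within_open[OF has_derivative_const])
  show "open (- \<Union>\<T>)"
    using compact_mesh by (intro open_Compl compact_imp_closed)
  show "x \<in> - \<Union>\<T>"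
    using x by simp
  show "0 = v y" if "y \<in> - \<Union>\<T>" for y
    using fe_outside[OF v, of y] that by simp
qed

text \<open>Frontiers of convex sets are negligible. Off these finitely many, a point is interior to
  a tetrahedron or outside the closed mesh, and near it \<open>v\<close> is a single affine
  function.\<close>

lemma fe_diff_quot_tendsto_AE:
  assumes v: "v \<in> S"
  shows "AE x in lborel. \<forall>i. (\<lambda>n. diff_quot v (axis i 1) n x) \<longlonglongrightarrow> fe_grad v x $ i"
proof -
  have "negligible (\<Union>K\<in>\<T>. frontier K)"
    using finite_mesh mesh_compact_convex(2)
    by (intro negligible_Union) (auto intro: negligible_convex_frontier)
  then have "AE x in lebesgue. x \<notin> (\<Union>K\<in>\<T>. frontier K)"
    by (intro AE_not_in) (simp add: negligible_iff_null_sets)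
  then have "AE x in lborel. x \<notin> (\<Union>K\<in>\<T>. frontier K)"
    by (simp only: AE_completion_iff)
  then show ?thesis
  proof eventually_elim
    case (elim x)
    show ?case
    proof (cases "x \<in> \<Union>\<T>")
      case True
      then obtain K where K: "K \<in> \<T>" "x \<in> K" by blast
      with elim have "x \<in> interior K"
        using mesh_compact_convex(1)[OF K(1)] by (auto simp: frontier_def compact_imp_closed)
      moreover obtain a b where "\<forall>x\<in>K. v x = a \<bullet> x + b"
        by (rule fe_affine[OF v K(1)])
      ultimately have "(v has_derivative (\<lambda>h. a \<bullet> h)) (at x)"
        by (intro fe_has_derivative_interior)
      then show ?thesis
        by (intro allI fe_grad_eqI)
    next
      case False
      from fe_has_derivative_outside[OF v this] show ?thesis
        by (intro allI fe_grad_eqI)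
    qed
  qed
qed

lemma fe_diff_quot_measurable:
  assumes "v \<in> S"
  shows "diff_quot v e n \<in> borel_measurable borel"
proof -
  have "continuous_on UNIV (diff_quot v e n)"
    unfolding diff_quot_def
    by (intro continuous_intros continuous_on_compose2[OF fe_continuous[OF assms]] fe_continuous[OF assms]) auto
  then show ?thesis
    by (rule borel_measurable_continuous_onI)
qed

text \<open>As a \<open>lim\<close> of continuous functions, \<open>fe_grad\<close> is Borel
  measurable on the whole space, including the points where the limit fails to exist.\<close>

lemma fe_grad_measurable:
  assumes "v \<in> S"
  shows "(\<lambda>x. fe_grad v x $ i) \<in> borel_measurable borel"
  using borel_measurable_lim_metric[of "diff_quot v (axis i 1)" borel] fe_diff_quot_measurable[OF assms]
  by (simp add: fe_grad_def)

lemma fe_grad_is_weak_grad: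
  assumes v: "v \<in> S"
  shows "is_weak_grad \<Omega> v (fe_grad v)"
  unfolding is_weak_grad_def
proof (intro conjI allI ballI)
  obtain L where L: "\<And>x y. \<bar>v x - v y\<bar> \<le> L * norm (x - y)"
    using fe_lipschitz[OF v] by blast
  have dq: "\<bar>diff_quot v (axis i 1) n x\<bar> \<le> L" for i n x
    using diff_quot_bound[of v L "axis i 1" n x, OF L] by simp
  fix i
  show "(\<lambda>x. fe_grad v x $ i) \<in> L2 \<Omega>"
  proof (rule AE_bounded_L2[where B = L])
    show "(\<lambda>x. fe_grad v x $ i) \<in> borel_measurable M"
      using fe_grad_measurable[OF v, of i]
      by (intro measurable_restrict_space1 measurable_completion) simp
    have "AE x in lborel. \<bar>fe_grad v x $ i\<bar> \<le> L"
      using fe_diff_quot_tendsto_AE[OF v]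
    proof eventually_elim
      case (elim x)
      then have "(\<lambda>n. \<bar>diff_quot v (axis i 1) n x\<bar>) \<longlonglongrightarrow> \<bar>fe_grad v x $ i\<bar>"
        by (intro tendsto_rabs) blast
      then show ?case
        by (rule LIMSEQ_le_const2) (use dq in blast)
    qed
    then have "AE x in lebesgue. \<bar>fe_grad v x $ i\<bar> \<le> L"
      by (rule AE_completion)
    then show "AE x in M. \<bar>fe_grad v x $ i\<bar> \<le> L"
      unfolding AE_restrict_space_iff[OF domain_sets] by eventually_elim simp
  qed
next
  fix \<psi> i
  assume \<psi>: "\<psi> \<in> test_fun \<Omega>"
  obtain L where L: "\<And>x y. \<bar>v x - v y\<bar> \<le> L * norm (x - y)"
    using fe_lipschitz[OF v] by blast
  have dq: "\<bar>diff_quot v (axis i 1) n x\<bar> \<le> L" for n x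
    using diff_quot_bound[of v L "axis i 1" n x, OF L] by simp
  obtain B where B: "\<And>x. \<bar>partial i \<psi> x\<bar> \<le> B"
    using test_fun_bounded[OF \<psi>, of i] by blast
  let ?C = "closure {x. \<psi> x \<noteq> 0}"
  have C: "compact ?C" "?C \<subseteq> \<Omega>"
    using \<psi> by (auto simp: test_fun_def)
  note v_cont = fe_continuous[OF v] and \<psi>_cont = test_fun_continuous(2)[OF \<psi>]
  have \<psi>_diff_cont: "continuous_on UNIV (diff_quot \<psi> e n)" for e n
    unfolding diff_quot_def
    by (intro continuous_intros continuous_on_compose2[OF \<psi>_cont] \<psi>_cont) auto
  have [measurable]: "v \<in> borel_measurable borel" "\<psi> \<in> borel_measurable borel"
      "partial i \<psi> \<in> borel_measurable borel" "\<And>e n. diff_quot \<psi> e n \<in> borel_measurable borel"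
      "\<And>e n. diff_quot v e n \<in> borel_measurable borel" "(\<lambda>x. fe_grad v x $ i) \<in> borel_measurable borel"
    using v_cont \<psi>_cont test_fun_continuous(3)[OF \<psi>] \<psi>_diff_cont
    by (auto intro: borel_measurable_continuous_onI fe_diff_quot_measurable[OF v] fe_grad_measurable[OF v])
  have int_v: "integrable lborel v"
    using fe_outside[OF v] by (rule continuous_vanishing_integrable[OF v_cont compact_mesh])
  have int_\<psi>: "integrable lborel \<psi>"
    using test_fun_vanishes(1)[OF \<psi>] by (rule continuous_vanishing_integrable[OF \<psi>_cont C(1)])
  have lim1: "(\<lambda>n. LINT x|lborel. diff_quot v (axis i 1) n x * \<psi> x)
      \<longlonglongrightarrow> (LINT x|lborel. fe_grad v x $ i * \<psi> x)"
  proof (rule integral_dominated_convergence[where w = "\<lambda>x. L * \<bar>\<psi> x\<bar>"])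
    show "AE x in lborel. (\<lambda>n. diff_quot v (axis i 1) n x * \<psi> x) \<longlonglongrightarrow> fe_grad v x $ i * \<psi> x"
      using fe_diff_quot_tendsto_AE[OF v] by eventually_elim (auto intro!: tendsto_intros)
    show "AE x in lborel. norm (diff_quot v (axis i 1) n x * \<psi> x) \<le> L * \<bar>\<psi> x\<bar>" for n
      using dq by (auto simp: abs_mult intro!: mult_right_mono)
  qed (use int_\<psi> in auto)
  have lim2: "(\<lambda>n. LINT x|lborel. v x * diff_quot \<psi> (- axis i 1) n x)
      \<longlonglongrightarrow> (LINT x|lborel. v x * (- partial i \<psi> x))"
  proof (rule integral_dominated_convergence[where w = "\<lambda>x. \<bar>v x\<bar> * B"])
    show "AE x in lborel. (\<lambda>n. v x * diff_quot \<psi> (- axis i 1) n x) \<longlonglongrightarrow> v x * (- partial i \<psi> x)"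
      by (intro AE_I2 tendsto_mult tendsto_const test_fun_diff_quot(1)[OF \<psi>])
    show "AE x in lborel. norm (v x * diff_quot \<psi> (- axis i 1) n x) \<le> \<bar>v x\<bar> * B" for n
      using test_fun_diff_quot(2)[OF \<psi> B] by (auto simp: abs_mult intro!: mult_left_mono)
  qed (use int_v in auto)
  \<comment> \<open>The two sequences whose limits were computed coincide term by term, so the
    limits agree; the support of \<open>\<psi>\<close> then confines both integrals to
    \<open>\<Omega>\<close>.\<close>
  have "(LINT x|lborel. diff_quot v (axis i 1) n x * \<psi> x) =
      (LINT x|lborel. v x * diff_quot \<psi> (- axis i 1) n x)" for n
    using fe_outside[OF v] test_fun_vanishes(1)[OF \<psi>]
    by (rule integral_diff_quot[OF v_cont \<psi>_cont compact_mesh _ C(1)])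
  with lim1 lim2 have "(LINT x|lborel. fe_grad v x $ i * \<psi> x) = (LINT x|lborel. v x * (- partial i \<psi> x))"
    by (simp only: LIMSEQ_unique)
  moreover have "(LINT x|M. v x * partial i \<psi> x) = (LINT x|lborel. v x * partial i \<psi> x)"
  proof (rule integral_domain_eq_lborel)
    show "v x * partial i \<psi> x = 0" if "x \<notin> \<Omega>" for x
      using test_fun_vanishes(2)[OF \<psi>, of x i] C(2) that by auto
  qed simp
  moreover have "(LINT x|M. fe_grad v x $ i * \<psi> x) = (LINT x|lborel. fe_grad v x $ i * \<psi> x)"
  proof (rule integral_domain_eq_lborel)
    show "fe_grad v x $ i * \<psi> x = 0" if "x \<notin> \<Omega>" for x
      using test_fun_vanishes(1)[OF \<psi>, of x] C(2) that by auto
  qed simp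
  ultimately show "(LINT x|M. v x * partial i \<psi> x) = - (LINT x|M. fe_grad v x $ i * \<psi> x)"
    by simp
qed

section \<open>Finite element functions as elements of \<open>H1\<close>, and definiteness of the
  two forms\<close>

lemma fe_measurable_L2:
  assumes "v \<in> S"
  shows "v \<in> borel_measurable M" "v \<in> L2 \<Omega>"
proof -
  show *: "v \<in> borel_measurable M"
    by (rule continuous_on_measurable_domain[OF fe_continuous[OF assms]])
  obtain B where "\<And>x. \<bar>v x\<bar> \<le> B"
    using fe_bounded[OF assms] by blast
  with * show "v \<in> L2 \<Omega>"
    by (intro AE_bounded_L2) auto
qed

lemma fe_H1: "v \<in> S \<Longrightarrow> v \<in> H1 \<Omega>"
  using fe_grad_is_weak_grad fe_measurable_L2 by (auto simp: H1_def)

text \<open>Vanishing almost everywhere on \<open>\<Omega>\<close> spreads by continuity to all of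
  \<open>\<Omega>\<close> and to its closure, which contains the mesh; outside the mesh
  \<open>v\<close> is zero by definition.\<close>

lemma fe_l2_definite:
  assumes v: "v \<in> S" and "l2_inner \<Omega> v v = 0"
  shows "v = (\<lambda>_. 0)"
proof -
  have "integrable M (\<lambda>x. v x * v x)"
    by (intro L2_mult_integrable fe_measurable_L2 v)
  then have "AE x in M. v x * v x = 0"
    using assms(2) integral_nonneg_eq_0_iff_AE[of M "\<lambda>x. v x * v x"] by (simp add: l2_inner_def)
  then have AE: "AE x in lebesgue. x \<in> \<Omega> \<longrightarrow> v x = 0"
    unfolding AE_restrict_space_iff[OF domain_sets] by simp
  have "open (\<Omega> \<inter> {x. v x \<noteq> 0})"
    using open_domain fe_continuous[OF v] by (intro open_Int open_Collect_neq continuous_on_const)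
  then have "\<Omega> \<inter> {x. v x \<noteq> 0} = {}"
    using AE_lebesgue_open_witness[OF AE] by blast
  then have "\<Omega> \<subseteq> {x. v x = 0}"
    by blast
  moreover have "closed {x. v x = 0}"
    using fe_continuous[OF v] by (intro closed_Collect_eq continuous_on_const)
  ultimately have "closure \<Omega> \<subseteq> {x. v x = 0}"
    by (rule closure_minimal)
  moreover have "\<Union>\<T> \<subseteq> closure \<Omega>"
    using mesh by (simp add: triangulation_of_def)
  ultimately show ?thesis
    using fe_outside[OF v] by (intro ext) blast
qed

text \<open>A finite element function with vanishing gradient has finite range (one value per
  tetrahedron, and zero), so by connectedness of the space it is constant. This takes the place
  of the Poincare inequality.\<close>

lemma fe_grad_definite:
  assumes v: "v \<in> S" and zero: "grad_inner \<Omega> v v = 0"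
  shows "v = (\<lambda>_. 0)"
proof -
  note wg = fe_grad_is_weak_grad[OF v]
  have "AE x in M. fe_grad v x \<bullet> fe_grad v x = 0"
    using zero integral_nonneg_eq_0_iff_AE[OF weak_grad_inner_integrable[OF wg wg]]
    by (simp add: grad_inner_eq[OF wg wg])
  then have AE: "AE x in lebesgue. x \<in> \<Omega> \<longrightarrow> fe_grad v x = 0"
    unfolding AE_restrict_space_iff[OF domain_sets] by simp
  have "\<exists>c. \<forall>K\<in>\<T>. \<forall>x\<in>K. v x = c K"
  proof (rule bchoice, rule ballI)
    fix K assume K: "K \<in> \<T>"
    obtain a b where ab: "\<forall>x\<in>K. v x = a \<bullet> x + b"
      by (rule fe_affine[OF v K])
    \<comment> \<open>The gradient is constant on the interior of \<open>K\<close>, so a single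
      point there with vanishing \<open>fe_grad\<close> suffices for \<open>a = 0\<close>.\<close>
    obtain x where x: "x \<in> interior K \<inter> \<Omega>" "x \<in> \<Omega> \<longrightarrow> fe_grad v x = 0"
      by (rule AE_lebesgue_open_witness[OF AE mesh_interior_meets_domain[OF K]])
    then have "a = 0"
      using fe_grad_eqI(1)[OF fe_has_derivative_interior[OF ab, of x]] by simp
    with ab show "\<exists>c. \<forall>x\<in>K. v x = c" by simp
  qed
  then obtain c where c: "\<forall>K\<in>\<T>. \<forall>x\<in>K. v x = c K"
    by (elim exE)
  have "v x \<in> insert 0 (c ` \<T>)" for x
  proof (cases "x \<in> \<Union>\<T>")
    case True
    with c show ?thesis by auto
  next
    case False
    then show ?thesis using fe_outside[OF v] by simp
  qed
  then have "finite (range v)"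
    using finite_mesh by (intro finite_subset[of "range v" "insert 0 (c ` \<T>)"]) auto
  then have "v constant_on UNIV"
    by (rule continuous_finite_range_constant[OF connected_UNIV fe_continuous[OF v]])
  then obtain d where d: "\<And>x. v x = d"
    by (auto simp: constant_on_def)
  \<comment> \<open>The constant is zero because the bounded mesh misses some point.\<close>
  have "\<Union>\<T> \<noteq> UNIV"
    using compact_mesh compact_imp_bounded not_bounded_UNIV by metis
  then obtain y where "y \<notin> \<Union>\<T>"
    by blast
  then have "d = 0"
    using d fe_outside[OF v] by metis
  with d show ?thesis by auto
qed

end

section \<open>The scheme\<close>

context fe_mesh
begin

lemma fe_l2_pos:
  assumes "v \<in> S" "v \<noteq> (\<lambda>_. 0)"
  shows "0 < l2_inner \<Omega> v v"
proof -
  have "0 \<le> l2_inner \<Omega> v v"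
    by (simp add: l2_inner_def)
  moreover have "l2_inner \<Omega> v v \<noteq> 0"
    using fe_l2_definite assms by blast
  ultimately show ?thesis by simp
qed

text \<open>\<open>grad_inner\<close> is an inner product on \<open>S\<close>, so the Riesz argument
  gives existence and uniqueness, and the description by \<open>THE\<close> denotes the
  projection.\<close>

lemma ritz_in_fe_space:
  assumes u: "u \<in> H1 \<Omega>"
  shows "ritz \<Omega> S u \<in> S"
proof -
  obtain P where P: "finite P" "\<And>v. v \<in> S \<Longrightarrow> (\<And>p. p \<in> P \<Longrightarrow> v p = 0) \<Longrightarrow> v = (\<lambda>_. 0)"
    using fe_determined_by_vertices by blast
  have "\<exists>!w. w \<in> S \<and> (\<forall>v\<in>S. grad_inner \<Omega> w v = grad_inner \<Omega> u v)"
  proof (rule riesz_representation_on_function_space[OF P(1)])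
    show "grad_inner \<Omega> w w > 0" if "w \<in> S" "w \<noteq> (\<lambda>_. 0)" for w
      using that fe_grad_definite[of w] grad_inner_nonneg[of w] by fastforce
    show "v = (\<lambda>_. 0)" if "v \<in> S" "\<And>p. p \<in> P \<Longrightarrow> v p = 0" for v
      using that by (rule P(2))
    show "grad_inner \<Omega> v w = grad_inner \<Omega> w v" for v w
      by (rule grad_inner_commute)
    show "grad_inner \<Omega> (\<lambda>x. v x + c * w x) z = grad_inner \<Omega> v z + c * grad_inner \<Omega> w z"
      if "v \<in> S" "w \<in> S" "z \<in> S" for v w z c
      using that by (intro grad_inner_add_scale_left fe_H1)
    show "grad_inner \<Omega> u (\<lambda>x. v x + c * w x) = grad_inner \<Omega> u v + c * grad_inner \<Omega> u w"
      if "v \<in> S" "w \<in> S" for v w c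
      using that by (intro grad_inner_add_scale_right fe_H1 u)
  qed (fact fe_zero fe_add_scale)+
  from theI'[OF this] show ?thesis
    by (simp add: ritz_def)
qed

lemma normalized_in_fe_space:
  assumes "v \<in> S"
  shows "normalized \<Omega> v \<in> S"
  using fe_scale[OF assms, of "1 / l2_norm \<Omega> v"] by (simp add: normalized_def)

lemma l2_norm_normalized:
  assumes "l2_norm \<Omega> v \<noteq> 0"
  shows "l2_norm \<Omega> (normalized \<Omega> v) = 1"
proof -
  have "(l2_norm \<Omega> (normalized \<Omega> v))\<^sup>2 = l2_inner \<Omega> v v / (l2_norm \<Omega> v)\<^sup>2"
    unfolding l2_norm_power2[of "normalized \<Omega> v"]
    by (simp add: l2_inner_def normalized_def power2_eq_square)
  also have "\<dots> = 1"
    using assms by (simp add: l2_norm_power2[symmetric])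
  finally show ?thesis
    using power2_eq_1_iff[of "l2_norm \<Omega> (normalized \<Omega> v)"]
    by (auto simp: l2_norm_def)
qed

section \<open>One step of the scheme from an arbitrary finite element function\<close>

context
  fixes V \<phi> :: "space3 \<Rightarrow> real" and \<beta> \<tau> :: real
  assumes V: "V \<in> L2 \<Omega>" and \<tau>: "\<tau> > 0" and \<phi>: "\<phi> \<in> S"
begin

text \<open>Finite element functions are bounded, so multiplication by \<open>\<phi>\<close> does
  not leave \<open>L2\<close>. This and the next lemma make the right-hand side of the scheme linear
  in the test function.\<close>

lemma potential_term_L2: "(\<lambda>x. V x * \<phi> x) \<in> L2 \<Omega>"
proof -
  obtain B where "\<And>x. \<bar>\<phi> x\<bar> \<le> B"
    using fe_bounded[OF \<phi>] by blast
  then show ?thesis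
    by (intro L2_mult_bounded V fe_measurable_L2 \<phi>)
qed

lemma cubic_term_L2: "(\<lambda>x. \<bar>\<phi> x\<bar>\<^sup>2 * \<phi> x) \<in> L2 \<Omega>"
proof -
  obtain B where B: "\<And>x. \<bar>\<phi> x\<bar> \<le> B"
    using fe_bounded[OF \<phi>] by blast
  have "(\<lambda>x. (\<phi> x * \<phi> x) * \<phi> x) \<in> L2 \<Omega>"
    by (intro L2_mult_bounded[OF _ _ B] fe_measurable_L2 \<phi>)
  then show ?thesis
    by (simp add: power2_eq_square)
qed

text \<open>The squared norm cancels the denominator of \<open>mu\<close>, which leaves its
  numerator. This makes the potential and cubic terms cancel when the scheme is tested with
  \<open>\<phi>\<close>.\<close>

lemma mu_mult_l2_inner:
  assumes "l2_norm \<Omega> \<phi> \<noteq> 0"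
  shows "mu \<Omega> V \<beta> \<phi> * l2_inner \<Omega> \<phi> \<phi> =
    grad_inner \<Omega> \<phi> \<phi> + l2_inner \<Omega> (\<lambda>x. V x * \<phi> x) \<phi> + \<beta> * l2_inner \<Omega> (\<lambda>x. \<bar>\<phi> x\<bar>\<^sup>2 * \<phi> x) \<phi>"
proof -
  note L2\<phi> = fe_measurable_L2(2)[OF \<phi>]
  note wg = wgrad_is_weak_grad[OF fe_H1[OF \<phi>]]
  have "mu \<Omega> V \<beta> \<phi> * l2_inner \<Omega> \<phi> \<phi> =
      (LINT x|M. (norm (wgrad \<Omega> \<phi> x))\<^sup>2 + V x * \<bar>\<phi> x\<bar>\<^sup>2 + \<beta> * \<bar>\<phi> x\<bar> ^ 4)"
    using assms by (simp add: mu_def l2_norm_power2[symmetric])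
  also have "\<dots> = (LINT x|M. wgrad \<Omega> \<phi> x \<bullet> wgrad \<Omega> \<phi> x + V x * \<phi> x * \<phi> x
      + \<beta> * (\<bar>\<phi> x\<bar>\<^sup>2 * \<phi> x * \<phi> x))"
    by (intro Bochner_Integration.integral_cong)
       (auto simp: dot_square_norm power2_eq_square power4_eq_xxxx mult.assoc)
  also have "\<dots> = grad_inner \<Omega> \<phi> \<phi> + l2_inner \<Omega> (\<lambda>x. V x * \<phi> x) \<phi>
      + \<beta> * l2_inner \<Omega> (\<lambda>x. \<bar>\<phi> x\<bar>\<^sup>2 * \<phi> x) \<phi>"
    unfolding grad_inner_def l2_inner_def
    using weak_grad_inner_integrable[OF wg wg] L2_mult_integrable[OF potential_term_L2 L2\<phi>]
      L2_mult_integrable[OF cubic_term_L2 L2\<phi>]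
    by simp
  finally show ?thesis .
qed

lemma l2_inner_time_difference:
  assumes "w \<in> S" "v \<in> S"
  shows "l2_inner \<Omega> (\<lambda>x. (w x - \<phi> x) / \<tau>) v = l2_inner \<Omega> w v / \<tau> - l2_inner \<Omega> \<phi> v / \<tau>"
proof -
  note L2 = fe_measurable_L2(2)
  have "(\<lambda>x. (w x - \<phi> x) / \<tau> * v x) = (\<lambda>x. w x * v x / \<tau> - \<phi> x * v x / \<tau>)"
    by (auto simp: diff_divide_distrib left_diff_distrib)
  then show ?thesis
    unfolding l2_inner_def
    using L2_mult_integrable[OF L2[OF assms(1)] L2[OF assms(2)]] L2_mult_integrable[OF L2[OF \<phi>] L2[OF assms(2)]]
    by simp
qed

lemma scheme_step_ex1: "\<exists>!w. scheme_step \<Omega> V \<beta> S \<tau> \<phi> w"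
proof -
  note L2 = fe_measurable_L2(2)
  \<comment> \<open>\<open>B\<close> collects what depends on the unknown; the old value divided by
    \<open>\<tau>\<close> joins the data in \<open>F\<close>.\<close>
  define B where "B w v = l2_inner \<Omega> w v / \<tau> + grad_inner \<Omega> w v" for w v
  define F where "F v = l2_inner \<Omega> \<phi> v / \<tau> - l2_inner \<Omega> (\<lambda>x. V x * \<phi> x) v
      - \<beta> * l2_inner \<Omega> (\<lambda>x. \<bar>\<phi> x\<bar>\<^sup>2 * \<phi> x) v + mu \<Omega> V \<beta> \<phi> * l2_inner \<Omega> \<phi> v" for v
  have step_iff: "scheme_step \<Omega> V \<beta> S \<tau> \<phi> w \<longleftrightarrow> w \<in> S \<and> (\<forall>v\<in>S. B w v = F v)" for w
  proof (cases "w \<in> S")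
    case True
    have "(l2_inner \<Omega> (\<lambda>x. (w x - \<phi> x) / \<tau>) v + grad_inner \<Omega> w v =
        - l2_inner \<Omega> (\<lambda>x. V x * \<phi> x) v - \<beta> * l2_inner \<Omega> (\<lambda>x. \<bar>\<phi> x\<bar>\<^sup>2 * \<phi> x) v
        + mu \<Omega> V \<beta> \<phi> * l2_inner \<Omega> \<phi> v) \<longleftrightarrow> B w v = F v" if "v \<in> S" for v
      unfolding l2_inner_time_difference[OF True that] B_def F_def by linarith
    with True show ?thesis
      unfolding scheme_step_def by (simp cong: ball_cong)
  qed (simp add: scheme_step_def)
  obtain P where P: "finite P" "\<And>v. v \<in> S \<Longrightarrow> (\<And>p. p \<in> P \<Longrightarrow> v p = 0) \<Longrightarrow> v = (\<lambda>_. 0)"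
    using fe_determined_by_vertices by blast
  have "\<exists>!w. w \<in> S \<and> (\<forall>v\<in>S. B w v = F v)"
  proof (rule riesz_representation_on_function_space[OF P(1)])
    show "v = (\<lambda>_. 0)" if "v \<in> S" "\<And>p. p \<in> P \<Longrightarrow> v p = 0" for v
      using that by (rule P(2))
    show "B v w = B w v" for v w
      unfolding B_def using l2_inner_commute[of v w] grad_inner_commute[of v w] by simp
    show "B (\<lambda>x. v x + c * w x) z = B v z + c * B w z" if "v \<in> S" "w \<in> S" "z \<in> S" for v w z c
      unfolding B_def l2_inner_add_scale_left[OF that[THEN L2]] grad_inner_add_scale_left[OF that[THEN fe_H1]]
      by (simp add: add_divide_distrib distrib_left)
    \<comment> \<open>Strict positivity comes from the \<open>L2\<close> term; the gradient term
      only has to be nonnegative.\<close>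
    show "0 < B v v" if "v \<in> S" "v \<noteq> (\<lambda>_. 0)" for v
      unfolding B_def using fe_l2_pos[OF that] \<tau> grad_inner_nonneg[of v]
      by (intro add_pos_nonneg divide_pos_pos)
    show "F (\<lambda>x. v x + c * w x) = F v + c * F w" if "v \<in> S" "w \<in> S" for v w c
      unfolding F_def l2_inner_add_scale_right[OF L2[OF \<phi>] that[THEN L2]]
        l2_inner_add_scale_right[OF potential_term_L2 that[THEN L2]]
        l2_inner_add_scale_right[OF cubic_term_L2 that[THEN L2]]
      by (simp add: add_divide_distrib algebra_simps)
  qed (fact fe_zero fe_add_scale)+
  then show ?thesis
    by (simp only: step_iff)
qed

lemma scheme_step_nonzero:
  assumes step: "scheme_step \<Omega> V \<beta> S \<tau> \<phi> w" and nz: "l2_norm \<Omega> \<phi> \<noteq> 0"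
  shows "l2_norm \<Omega> w \<noteq> 0"
proof
  assume "l2_norm \<Omega> w = 0"
  have w: "w \<in> S"
    using step by (simp add: scheme_step_def)
  have "w = (\<lambda>_. 0)"
    using \<open>l2_norm \<Omega> w = 0\<close> l2_norm_power2[of w] by (intro fe_l2_definite w) simp
  then have "l2_inner \<Omega> w \<phi> = 0"
    by (simp add: l2_inner_def)
  \<comment> \<open>The chosen weak gradient of zero need not be zero pointwise, so linearity is
    used with zero written as \<open>w - w\<close>.\<close>
  have "grad_inner \<Omega> w \<phi> = 0"
    using grad_inner_add_scale_left[OF fe_H1[OF w] fe_H1[OF w] fe_H1[OF \<phi>], of "-1"] \<open>w = (\<lambda>_. 0)\<close>
    by simp
  have "l2_inner \<Omega> (\<lambda>x. (w x - \<phi> x) / \<tau>) \<phi> + grad_inner \<Omega> w \<phi> =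
      - l2_inner \<Omega> (\<lambda>x. V x * \<phi> x) \<phi> - \<beta> * l2_inner \<Omega> (\<lambda>x. \<bar>\<phi> x\<bar>\<^sup>2 * \<phi> x) \<phi>
      + mu \<Omega> V \<beta> \<phi> * l2_inner \<Omega> \<phi> \<phi>"
    using step \<phi> unfolding scheme_step_def by blast
  \<comment> \<open>The left-hand side is negative for nonzero \<open>\<phi>\<close>, while the
    gradient energy on the right is not.\<close>
  then have "- l2_inner \<Omega> \<phi> \<phi> / \<tau> = grad_inner \<Omega> \<phi> \<phi>"
    unfolding l2_inner_time_difference[OF w \<phi>] mu_mult_l2_inner[OF nz]
      \<open>l2_inner \<Omega> w \<phi> = 0\<close> \<open>grad_inner \<Omega> w \<phi> = 0\<close> by simp
  moreover have "0 < l2_inner \<Omega> \<phi> \<phi> / \<tau>"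
    using nz \<tau> by (simp add: l2_norm_power2[symmetric])
  ultimately show False
    using grad_inner_nonneg[of \<phi>] by simp
qed

end

text \<open>The two properties are carried together through the induction: membership gives the
  unique solution behind \<open>THE\<close>, and nonvanishing of one iterate makes the next solution
  nonzero, hence normalizable.\<close>

lemma iterate_in_fe_space:
  assumes V: "V \<in> L2 \<Omega>" and \<tau>: "\<tau> > 0" and u: "u \<in> H1 \<Omega>"
    and initial: "l2_norm \<Omega> (ritz \<Omega> S u) \<noteq> 0"
  shows "iterate \<Omega> V \<beta> S \<tau> u n \<in> S \<and> l2_norm \<Omega> (iterate \<Omega> V \<beta> S \<tau> u n) \<noteq> 0"
proof (induction n)
  case 0
  show ?case
    using normalized_in_fe_space[OF ritz_in_fe_space[OF u]] l2_norm_normalized[OF initial] by simp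
next
  case (Suc n)
  define \<phi> where "\<phi> = iterate \<Omega> V \<beta> S \<tau> u n"
  have \<phi>: "\<phi> \<in> S" "l2_norm \<Omega> \<phi> \<noteq> 0"
    using Suc by (simp_all add: \<phi>_def)
  have step: "scheme_step \<Omega> V \<beta> S \<tau> \<phi> (step_solution \<Omega> V \<beta> S \<tau> \<phi>)"
    unfolding step_solution_def by (rule theI'[OF scheme_step_ex1[OF V \<tau> \<phi>(1)]])
  then have "step_solution \<Omega> V \<beta> S \<tau> \<phi> \<in> S"
    by (simp add: scheme_step_def)
  with l2_norm_normalized[OF scheme_step_nonzero[OF V \<tau> \<phi>(1) step \<phi>(2)]] show ?case
    by (simp add: normalized_in_fe_space \<phi>_def[symmetric])
qed

end

text \<open>\<open>initial_value_defined\<close> gives the quotient that defines the initial value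
  its meaning. It can fail on coarse meshes: for a single tetrahedron \<open>fe_space\<close>
  contains only zero, because an affine function vanishing on all faces is zero, and so the Ritz
  projection vanishes.\<close>

theorem theorem4p1:
  fixes \<Omega> :: "(real^3) set" and V \<phi>0 :: "real^3 \<Rightarrow> real" and \<beta> T \<tau> h :: real and N :: nat
    and H :: "real set" and \<T> :: "real \<Rightarrow> (real^3) set set"
  assumes "open \<Omega>" and "\<Omega> \<noteq> {}" and "connected \<Omega>" and "bounded \<Omega>" and "convex \<Omega>"
    and "smooth_boundary \<Omega>"
    and "V \<in> L2 \<Omega>" and "AE x in lebesgue_on \<Omega>. V x \<ge> 0" and "\<beta> \<ge> 0"
    and "\<phi>0 \<in> H10 \<Omega>" and "l2_norm \<Omega> \<phi>0 = 1"
    and "T > 0" and "N \<ge> 1" and "\<tau> = T / real N"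
    and "\<And>h. h \<in> H \<Longrightarrow> h > 0 \<and> triangulation_of \<Omega> (\<T> h) \<and> mesh_size (\<T> h) = h"
    and "shape_regular H \<T>" and "quasi_uniform H \<T>"
    and "h \<in> H"
    and initial_value_defined: "l2_norm \<Omega> (ritz \<Omega> (fe_space (\<T> h)) \<phi>0) \<noteq> 0"
  shows "\<forall>n<N.
    (\<exists>!w. scheme_step \<Omega> V \<beta> (fe_space (\<T> h)) \<tau> (iterate \<Omega> V \<beta> (fe_space (\<T> h)) \<tau> \<phi>0 n) w) \<and>
    l2_norm \<Omega> (step_solution \<Omega> V \<beta> (fe_space (\<T> h)) \<tau>
                 (iterate \<Omega> V \<beta> (fe_space (\<T> h)) \<tau> \<phi>0 n)) \<noteq> 0"
proof (intro allI impI)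
  fix n assume "n < N"
  interpret fe_mesh \<Omega> "\<T> h"
    using assms(1,4) assms(15)[OF \<open>h \<in> H\<close>] by unfold_locales simp_all
  have \<tau>: "\<tau> > 0"
    using \<open>T > 0\<close> \<open>N \<ge> 1\<close> \<open>\<tau> = T / real N\<close> by simp
  have \<phi>0: "\<phi>0 \<in> H1 \<Omega>"
    using \<open>\<phi>0 \<in> H10 \<Omega>\<close> by (simp add: H10_def)
  define \<phi> where "\<phi> = iterate \<Omega> V \<beta> (fe_space (\<T> h)) \<tau> \<phi>0 n"
  have \<phi>: "\<phi> \<in> fe_space (\<T> h)" "l2_norm \<Omega> \<phi> \<noteq> 0"
    using iterate_in_fe_space[OF \<open>V \<in> L2 \<Omega>\<close> \<tau> \<phi>0 initial_value_defined] by (simp_all add: \<phi>_def)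
  have ex1: "\<exists>!w. scheme_step \<Omega> V \<beta> (fe_space (\<T> h)) \<tau> \<phi> w"
    by (rule scheme_step_ex1[OF \<open>V \<in> L2 \<Omega>\<close> \<tau> \<phi>(1)])
  have "l2_norm \<Omega> (step_solution \<Omega> V \<beta> (fe_space (\<T> h)) \<tau> \<phi>) \<noteq> 0"
    unfolding step_solution_def
    by (rule scheme_step_nonzero[OF \<open>V \<in> L2 \<Omega>\<close> \<tau> \<phi>(1) theI'[OF ex1] \<phi>(2)])
  with ex1 show "(\<exists>!w. scheme_step \<Omega> V \<beta> (fe_space (\<T> h)) \<tau> (iterate \<Omega> V \<beta> (fe_space (\<T> h)) \<tau> \<phi>0 n) w) \<and>
      l2_norm \<Omega> (step_solution \<Omega> V \<beta> (fe_space (\<T> h)) \<tau> (iterate \<Omega> V \<beta> (fe_space (\<T> h)) \<tau> \<phi>0 n)) \<noteq> 0"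
    unfolding \<phi>_def by (rule conjI)
qed

end
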